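(* Let $\mu\in\mathcal C_o$, $n\in\mathbb N$, $\lambda,x,y,z\in\mathbb C$ with $|z|<1$. Then: (1) $\mathfrak D_{\mu,x}\big(H_n^\mu(\lambda x)\big)=2\lambda n\,H_{n-1}^\mu(\lambda x)$. (2) $(2\mathfrak Q-\mathfrak D_\mu)H_n^\mu=\dfrac{\gamma_\mu(n+1)}{(n+1)\gamma_\mu(n)}H_{n+1}^\mu=\left(1+\dfrac{2\mu\theta_{n+1}}{n+1}\right)H_{n+1}^\mu$. (3) (Three term recursion) $2nH_{n-1}^\mu+\dfrac{\gamma_\mu(n+1)}{(n+1)\gamma_\mu(n)}H_{n+1}^\mu=2\mathfrak Q H_n^\mu$, where $H_{-1}^\mu=0$. (4) $\mathfrak D_{\mu,x}\big(e^{-\lambda^2x^2}H_n^\mu(\lambda x)\big)=-\lambda e^{-\lambda^2x^2}\dfrac{\gamma_\mu(n+1)}{(n+1)\gamma_\mu(n)}H_{n+1}^\mu(\lambda x)$. (5) (Rodrigues formula) $(-1)^ne^{\lambda^2x^2}\,\mathfrak D_{\mu,x}^n\,e^{-\lambda^2x^2}=\lambda^n\dfrac{\gamma_\mu(n)}{n!}H_n^\mu(\lambda x)$. (6) $H_n^\mu=\dfrac{n!}{\gamma_\mu(n)}(2\mathfrak Q-\mathfrak D_\mu)^nH_0^\mu$. (7) (Inversion formula) $\dfrac{(2x)^n}{\gamma_\mu(n)}=\displaystyle\sum_{k=0}^{\lfloor n/2\rfloor}\dfrac{H_{n-2k}^\mu(x)}{k!\,(n-2k)!}$. (8) (Mehler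 formula) $\displaystyle\sum_{n=0}^\infty\frac{\gamma_\mu(n)}{2^n(n!)^2}H_n^\mu(x)H_n^\mu(y)z^n=\frac{1}{(1-z^2)^{\mu+\frac12}}\exp\!\left(-(x^2+y^2)\frac{z^2}{1-z^2}\right)\boldsymbol e_\mu\!\left(2xy\frac{z}{1-z^2}\right)$. (9) $\displaystyle\sum_{n=0}^\infty\frac{\gamma_\mu(2n)}{(2n)!}H_{2n}^\mu(x)\frac{(-1)^n}{n!}\left(\frac z2\right)^{2n}=\frac{1}{(1-z^2)^{\mu+\frac12}}\exp\!\left(\frac{-x^2z^2}{1-z^2}\right)$.
   Context: $\mathbb N=\{0,1,2,\dots\}$; $\mathcal C_o=\mathbb C\setminus\{-\frac12,-\frac32,-\frac52,\dots\}$. For $\mu\in\mathcal C_o$ and $m\in\mathbb N$: $\gamma_\mu(2m)=\frac{2^{2m}m!\,\Gamma(m+\mu+\frac12)}{\Gamma(\mu+\frac12)}$, $\gamma_\mu(2m+1)=\frac{2^{2m+1}m!\,\Gamma(m+\mu+\frac32)}{\Gamma(\mu+\frac12)}$; $\theta_k=0$ for $k$ even and $\theta_k=1$ for $k$ odd. The entire function $\boldsymbol e_\mu(x)=\sum_{m=0}^\infty x^m/\gamma_\mu(m)$. The generalized Hermite polynomials $H_n^\mu$, $n\in\mathbb N$, are $H_{2m}^\mu(x)=(-1)^m\frac{(2m)!}{m!}\sum_{k=0}^m(-1)^k\binom mk\frac{\Gamma(\mu+\frac12)}{\Gamma(k+\mu+\frac12)}x^{2k}$ and $H_{2m+1}^\mu(x)=(-1)^m\frac{(2m+1)!}{m!}\sum_{k=0}^m(-1)^k\binom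 mk\frac{\Gamma(\mu+\frac12)}{\Gamma(k+\mu+\frac32)}x^{2k+1}$; set $H_{-1}^\mu=0$. On entire functions $\phi$, $\mathfrak D_\mu\phi(x)=\phi'(x)+\frac{\mu}{x}(\phi(x)-\phi(-x))$ (with the removable singularity at $x=0$ filled in) and $\mathfrak Q\phi(x)=x\phi(x)$. $\mathfrak D_{\mu,x}$ means $\mathfrak D_\mu$ acting on functions of the variable $x$. $(1-z^2)^{\mu+\frac12}$ is the principal branch. *)

theory Defs
  imports "HOL-Complex_Analysis.Complex_Analysis"
begin

definition C_o :: "complex set" where
  "C_o = - range (\<lambda>k::nat. - (of_nat k + 1/2))"

definition gamma_mu :: "complex \<Rightarrow> nat \<Rightarrow> complex" where
  "gamma_mu \<mu> n = (let m = n div 2 in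
     if even n
     then 2 ^ (2 * m) * fact m * Gamma (of_nat m + \<mu> + 1/2) / Gamma (\<mu> + 1/2)
     else 2 ^ (2 * m + 1) * fact m * Gamma (of_nat m + \<mu> + 3/2) / Gamma (\<mu> + 1/2))"

definition theta :: "nat \<Rightarrow> complex" where
  "theta k = (if even k then 0 else 1)"

definition e_mu :: "complex \<Rightarrow> complex \<Rightarrow> complex" where
  "e_mu \<mu> x = (\<Sum>m. x ^ m / gamma_mu \<mu> m)"

(* The degree is an integer so that the convention for degree -1 is available;
   all negative degrees give the zero function. *)
definition gen_hermite :: "complex \<Rightarrow> int \<Rightarrow> complex \<Rightarrow> complex" where
  "gen_hermite \<mu> n x =
     (if n < 0 then 0 else let m = nat n div 2 in
      if even n
      then (-1) ^ m * (fact (2 * m) / fact m) *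
        (\<Sum>k\<le>m. (-1) ^ k * of_nat (m choose k)
           * (Gamma (\<mu> + 1/2) / Gamma (of_nat k + \<mu> + 1/2)) * x ^ (2 * k))
      else (-1) ^ m * (fact (2 * m + 1) / fact m) *
        (\<Sum>k\<le>m. (-1) ^ k * of_nat (m choose k)
           * (Gamma (\<mu> + 1/2) / Gamma (of_nat k + \<mu> + 3/2)) * x ^ (2 * k + 1)))"

definition dunkl :: "complex \<Rightarrow> (complex \<Rightarrow> complex) \<Rightarrow> complex \<Rightarrow> complex" where
  "dunkl \<mu> \<phi> x = deriv \<phi> x + remove_sings (\<lambda>t. \<mu> / t * (\<phi> t - \<phi> (- t))) x"

definition Q_op :: "(complex \<Rightarrow> complex) \<Rightarrow> complex \<Rightarrow> complex" where
  "Q_op \<phi> x = x * \<phi> x"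

(* The operator 2 Q - D. *)
definition raising_op :: "complex \<Rightarrow> (complex \<Rightarrow> complex) \<Rightarrow> complex \<Rightarrow> complex" where
  "raising_op \<mu> \<phi> x = 2 * Q_op \<phi> x - dunkl \<mu> \<phi> x"

lemma dunkl_nonzero:
  assumes "\<phi> holomorphic_on UNIV" "x \<noteq> 0"
  shows "dunkl \<mu> \<phi> x = deriv \<phi> x + \<mu> / x * (\<phi> x - \<phi> (- x))"
proof -
  have c: "continuous_on UNIV \<phi>"
    using assms(1) by (rule holomorphic_on_imp_continuous_on)
  have "isCont \<phi> t" for t
    using c by (simp add: continuous_on_eq_continuous_at)
  then have "((\<lambda>t. \<mu> / t * (\<phi> t - \<phi> (- t))) \<longlongrightarrow> \<mu> / x * (\<phi> x - \<phi> (- x))) (at x)"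
    using assms(2) by (intro tendsto_intros isCont_tendsto_compose[where g = \<phi>]) auto
  then show ?thesis
    unfolding dunkl_def by (simp add: remove_sings_eqI)
qed

lemma dunkl_zero:
  assumes "\<phi> holomorphic_on UNIV"
  shows "dunkl \<mu> \<phi> 0 = (1 + 2 * \<mu>) * deriv \<phi> 0"
proof -
  have d: "(\<phi> has_field_derivative deriv \<phi> 0) (at 0)"
    using assms by (intro holomorphic_derivI[of \<phi> UNIV]) auto
  have d': "((\<lambda>t. \<phi> (- t)) has_field_derivative - deriv \<phi> 0) (at 0)"
  proof -
    have "(uminus has_field_derivative (-1)) (at (0::complex))"
      by (auto intro!: derivative_eq_intros)
    then show ?thesis
      using DERIV_chain2[of \<phi> "deriv \<phi> 0" uminus 0 "-1" UNIV] d by simp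
  qed
  have "((\<lambda>t. \<phi> t - \<phi> (- t)) has_field_derivative 2 * deriv \<phi> 0) (at 0)"
    using DERIV_diff[OF d d'] by simp
  then have "((\<lambda>t. (\<phi> t - \<phi> (- t)) / t) \<longlongrightarrow> 2 * deriv \<phi> 0) (at 0)"
    by (simp add: has_field_derivative_iff)
  then have "((\<lambda>t. \<mu> * ((\<phi> t - \<phi> (- t)) / t)) \<longlongrightarrow> \<mu> * (2 * deriv \<phi> 0)) (at 0)"
    by (rule tendsto_mult_left)
  then have "remove_sings (\<lambda>t. \<mu> / t * (\<phi> t - \<phi> (- t))) 0 = \<mu> * (2 * deriv \<phi> 0)"
    by (intro remove_sings_eqI) simp
  then show ?thesis
    unfolding dunkl_def by (simp add: algebra_simps)
qed

end

theory Submission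
  imports Defs
begin

text \<open>
  Put \<open>a = \<mu> + 1/2\<close>; the condition on \<open>\<mu>\<close> says that \<open>a\<close> is not a non-positive integer. Everything
  rests on two descriptions of \<open>H\<^sub>n\<close>.

  \<^bold>\<open>Algebraic part.\<close> Writing \<open>u\<^sub>j(x) = (2x)\<^sup>j / \<gamma>(j)\<close>, one has
  \<open>H\<^sub>n / n! = \<Sum>\<^sub>k (-1)\<^sup>k / k! u\<^bsub>n-2k\<^esub>\<close> (lemma \<open>gen_hermite_expansion\<close>). For a fixed parity of \<open>n\<close> this is
  the product of the formal power series \<open>exp (-X)\<close> with the series of the \<open>u\<^sub>j\<close>. Multiplication by
  \<open>exp X\<close> yields the inversion formula, and the relation \<open>2x u\<^sub>j = (\<gamma>(j+1)/\<gamma>(j)) u\<^bsub>j+1\<^esub>\<close> yields the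
  three term recursion. The operator \<open>\<DD>\<close> maps \<open>u\<^sub>j\<close> to \<open>2u\<^bsub>j-1\<^esub>\<close>, hence \<open>H\<^sub>n\<close> to \<open>2n H\<^bsub>n-1\<^esub>\<close>; combined with
  the recursion and the product rule for an even factor this gives the raising relations, and by
  iteration the Rodrigues formula.

  \<^bold>\<open>Analytic part.\<close> Up to elementary factors, \<open>H\<^bsub>2m\<^esub>(x)\<close> and \<open>H\<^bsub>2m+1\<^esub>(x) / x\<close> are the terminating Kummer series
  \<open>M\<^sub>m(X) = \<^sub>1F\<^sub>1(-m; b; X)\<close> at \<open>X = x\<^sup>2\<close> with \<open>b = a\<close> and \<open>b = a + 1\<close>. The even and odd
  parts of Mehler's formula are therefore two instances of the Hille--Hardy formula
  \<open>\<Sum>\<^sub>m (a)\<^sub>m / m! w\<^sup>m M\<^sub>m(X) M\<^sub>m(Y) = (1-w)\<^bsup>-a\<^esup> exp (-(X+Y)w/(1-w)) \<^sub>0F\<^sub>1(; a; XYw/(1-w)\<^sup>2)\<close>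
  (lemma \<open>hille_hardy\<close>). To prove it, expand \<open>M\<^sub>m(Y)\<close> and interchange the two summations
  (lemma \<open>binomial_transform_sums\<close>); the inner sums are
  \<open>\<Sum>\<^sub>i (a+l)\<^sub>i / i! w\<^sup>i M\<^bsub>i+l\<^esub>(X) = (1-w)\<^bsup>-a-l\<^esup> exp (-Xw/(1-w)) M\<^sub>l(X/(1-w))\<close> (lemma
  \<open>kummer_poly_genfun\<close>). This identity is proved by induction on \<open>l\<close>: differentiating
  in \<open>w\<close> replaces \<open>l\<close> by \<open>l + 1\<close>, and the base case is the same interchange of summation with
  constant inner coefficients. It also is the last claim of the theorem, by taking \<open>l = 0\<close>.
\<close>

section \<open>Pochhammer symbols and binomial series\<close>

lemma pochhammer_neq_0:
  fixes a :: "'a :: field_char_0"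
  assumes "\<And>k. a + of_nat k \<noteq> 0"
  shows "pochhammer a n \<noteq> 0"
  using assms by (auto simp: pochhammer_eq_0_iff eq_neg_iff_add_eq_0)

lemma pochhammer_nonneg':
  assumes "0 \<le> (x :: real)"
  shows "0 \<le> pochhammer x n"
  using assms by (auto simp: pochhammer_prod intro!: prod_nonneg)

lemma norm_pochhammer_le: "norm (pochhammer (a :: complex) n) \<le> pochhammer (norm a) n"
proof (induction n)
  case (Suc n)
  have "norm (a + of_nat n) \<le> norm a + of_nat n"
    by (metis norm_of_nat norm_triangle_ineq)
  with Suc show ?case
    by (auto simp: pochhammer_Suc norm_mult intro!: mult_mono pochhammer_nonneg'
        intro: add_nonneg_nonneg)
qed simp

lemma pochhammer_mono_real:
  assumes "0 \<le> x" "x \<le> (y :: real)"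
  shows "pochhammer x n \<le> pochhammer y n"
  using assms by (auto simp: pochhammer_prod intro!: prod_mono)

lemma pochhammer_series_complex:
  assumes "norm (w :: complex) < 1"
  shows "(\<lambda>i. pochhammer a i / fact i * w ^ i) sums ((1 - w) powr (- a))"
proof -
  have "(- a gchoose i) * (- w) ^ i = pochhammer a i / fact i * w ^ i" for i
    by (cases "even i") (simp_all add: gbinomial_pochhammer)
  then show ?thesis
    using gen_binomial_complex[of "- w" "- a"] assms by simp
qed

lemma pochhammer_series_real:
  assumes "\<bar>w :: real\<bar> < 1"
  shows "(\<lambda>i. pochhammer a i / fact i * w ^ i) sums ((1 - w) powr (- a))"
proof -
  have "(- a gchoose i) * (- w) ^ i = pochhammer a i / fact i * w ^ i" for i
    by (cases "even i") (simp_all add: gbinomial_pochhammer)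
  then show ?thesis
    using gen_binomial_real[of "- w" "- a"] assms by simp
qed

lemma exp_sums: "(\<lambda>n. z ^ n / fact n) sums exp (z :: complex)"
  using exp_converges[of z] by (simp add: scaleR_conv_of_real divide_inverse mult.commute)

lemma summable_power_over_pochhammer:
  fixes a x :: complex
  assumes a: "\<And>k. a + of_nat k \<noteq> 0"
  shows "summable (\<lambda>k. norm (x ^ k / pochhammer a k))"
proof -
  obtain N :: nat where N: "real N \<ge> 2 * norm x + norm a"
    using real_arch_simple by blast
  show ?thesis
  proof (rule summable_ratio_test[of "1/2" N])
    fix n assume "n \<ge> N"
    then have "norm (a + of_nat n) \<ge> 2 * norm x"
      using N norm_diff_ineq[of "of_nat n" a] by (simp add: add.commute)
    moreover have "norm (a + of_nat n) > 0"
      using a by simp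
    ultimately have "norm x / norm (a + of_nat n) \<le> 1/2"
      by (simp add: field_simps)
    then have "norm x / norm (a + of_nat n) * norm (x ^ n / pochhammer a n)
                 \<le> 1/2 * norm (x ^ n / pochhammer a n)"
      by (rule mult_right_mono) simp
    then show "norm (norm (x ^ Suc n / pochhammer a (Suc n)))
                 \<le> 1/2 * norm (norm (x ^ n / pochhammer a n))"
      by (simp add: pochhammer_Suc norm_mult norm_divide mult_ac)
  qed simp
qed

section \<open>Terminating Kummer series\<close>

text \<open>
  The polynomial \<open>\<^sub>1F\<^sub>1(-m; a; X)\<close>, a Laguerre polynomial normalised to the value 1 at \<open>X = 0\<close>.
\<close>
definition kummer_poly :: "complex \<Rightarrow> nat \<Rightarrow> complex \<Rightarrow> complex" where
  "kummer_poly a m X = (\<Sum>k\<le>m. of_nat (m choose k) * (- X) ^ k / pochhammer a k)"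

lemma kummer_poly_0 [simp]: "kummer_poly a 0 X = 1"
  by (simp add: kummer_poly_def)

text \<open>
  The polynomials grow subexponentially in the degree: split \<open>X\<^sup>k = \<epsilon>\<^sup>k (X/\<epsilon>)\<^sup>k\<close>, bound
  \<open>(X/\<epsilon>)\<^sup>k / (a)\<^sub>k\<close> uniformly in \<open>k\<close> and sum the remaining binomial expansion of \<open>(1 + \<epsilon>)\<^sup>m\<close>. Hence
  any power series with coefficients \<open>(a)\<^sub>m / m! M\<^sub>m(X)\<close> converges on the whole unit disc.
\<close>
lemma kummer_poly_bound:
  assumes a: "\<And>k. a + of_nat k \<noteq> 0" and "\<epsilon> > 0"
  obtains C where "C \<ge> 0" "\<And>m. norm (kummer_poly a m X) \<le> C * (1 + \<epsilon>) ^ m"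
proof -
  have "summable (\<lambda>k. norm ((- X / of_real \<epsilon>) ^ k / pochhammer a k))"
    by (rule summable_power_over_pochhammer[OF a])
  then have "Bseq (\<lambda>k. norm ((- X / of_real \<epsilon>) ^ k / pochhammer a k))"
    by (rule summable_imp_Bseq)
  then obtain C where "\<forall>k. norm (norm ((- X / of_real \<epsilon>) ^ k / pochhammer a k)) \<le> C"
    by (rule BseqE)
  then have C: "norm ((- X / of_real \<epsilon>) ^ k / pochhammer a k) \<le> C" for k
    by simp
  have "norm (kummer_poly a m X) \<le> C * (1 + \<epsilon>) ^ m" for m
  proof -
    have "norm (kummer_poly a m X)
            \<le> (\<Sum>k\<le>m. norm (of_nat (m choose k) * (- X) ^ k / pochhammer a k))"
      unfolding kummer_poly_def by (rule norm_sum)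
    also have "\<dots> = (\<Sum>k\<le>m. real (m choose k) * \<epsilon> ^ k *
                        norm ((- X / of_real \<epsilon>) ^ k / pochhammer a k))"
      using \<open>\<epsilon> > 0\<close> by (intro sum.cong)
        (auto simp: norm_mult norm_divide norm_power power_divide)
    also have "\<dots> \<le> (\<Sum>k\<le>m. real (m choose k) * \<epsilon> ^ k * C)"
      using \<open>\<epsilon> > 0\<close> C by (intro sum_mono mult_left_mono) auto
    also have "\<dots> = (\<Sum>k\<le>m. real (m choose k) * \<epsilon> ^ k * 1 ^ (m - k)) * C"
      by (simp add: sum_distrib_right)
    also have "\<dots> = C * (1 + \<epsilon>) ^ m"
      unfolding binomial_ring[symmetric] by (simp add: add.commute mult.commute)
    finally show ?thesis .
  qed
  moreover have "C \<ge> 0"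
    using C[of 0] norm_ge_zero order_trans by blast
  ultimately show ?thesis
    using that by blast
qed

text \<open>
  The raising relation \<open>X M\<^sub>l' + (a + l - X) M\<^sub>l = (a + l) M\<^bsub>l+1\<^esub>\<close>. Comparing coefficients reduces it to
  \<open>k (l choose k) = (l - k + 1) (l choose (k - 1))\<close>.
\<close>
lemma kummer_poly_derivative:
  assumes a: "\<And>k. a + of_nat k \<noteq> 0"
  obtains D where "(kummer_poly a l has_field_derivative D) (at X)"
    "X * D = (a + of_nat l) * kummer_poly a (Suc l) X - (a + of_nat l - X) * kummer_poly a l X"
proof
  define D where "D = (\<Sum>k\<le>l. of_nat (l choose k) * (of_nat k * (- X) ^ (k - 1) * (-1)) / pochhammer a k)"
  show "(kummer_poly a l has_field_derivative D) (at X)"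
    unfolding kummer_poly_def[abs_def] D_def
    by (auto intro!: derivative_eq_intros sum.cong simp: pochhammer_neq_0[OF a])
  have nz: "pochhammer a k \<noteq> 0" for k
    by (rule pochhammer_neq_0[OF a])
  have XD: "X * D = (\<Sum>k\<le>Suc l. of_nat k * of_nat (l choose k) * (- X) ^ k / pochhammer a k)"
    (is "_ = sum ?d _")
  proof -
    have "X * D = (\<Sum>k\<le>l. ?d k)"
      unfolding D_def sum_distrib_left
    proof (intro sum.cong refl)
      fix k
      show "X * (of_nat (l choose k) * (of_nat k * (- X) ^ (k - 1) * - 1) / pochhammer a k) = ?d k"
        by (cases k) auto
    qed
    then show ?thesis
      by simp
  qed
  have M: "kummer_poly a l X = (\<Sum>k\<le>Suc l. of_nat (l choose k) * (- X) ^ k / pochhammer a k)"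
    by (simp add: kummer_poly_def)
  have XM: "X * kummer_poly a l X
              = - (\<Sum>k\<le>Suc l. if k = 0 then 0 else
                     (a + of_nat k - 1) * of_nat (l choose (k - 1)) * (- X) ^ k / pochhammer a k)"
  proof -
    have "X * (of_nat (l choose k) * (- X) ^ k / pochhammer a k)
        = - ((a + of_nat (Suc k) - 1) * of_nat (l choose k) * (- X) ^ Suc k / pochhammer a (Suc k))" for k
    proof -
      have "a + of_nat (Suc k) - 1 = a + of_nat k" by simp
      then show ?thesis
        using a[of k] nz[of k] by (simp add: pochhammer_Suc mult_ac)
    qed
    then show ?thesis
      unfolding kummer_poly_def sum_distrib_left
      by (subst sum.atMost_Suc_shift) (simp add: sum_negf del: power_Suc of_nat_Suc)
  qed
  have "(a + of_nat l) * kummer_poly a (Suc l) X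
          = (a + of_nat l) * kummer_poly a l X - X * kummer_poly a l X + X * D"
    unfolding XM XD unfolding M unfolding kummer_poly_def sum_distrib_left diff_minus_eq_add
      sum.distrib[symmetric]
  proof (intro sum.cong refl)
    fix k
    show "(a + of_nat l) * (of_nat (Suc l choose k) * (- X) ^ k / pochhammer a k) =
         (a + of_nat l) * (of_nat (l choose k) * (- X) ^ k / pochhammer a k) +
         (if k = 0 then 0
          else (a + of_nat k - 1) * of_nat (l choose (k - 1)) * (- X) ^ k / pochhammer a k) +
         of_nat k * of_nat (l choose k) * (- X) ^ k / pochhammer a k"
    proof (cases k)
      case (Suc j)
      have absorb: "of_nat (Suc j) * of_nat (l choose Suc j) = (of_nat l - of_nat j) * (of_nat (l choose j) :: complex)"
      proof (cases "j \<le> l")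
        case True
        have "Suc j * (l choose Suc j) = (l - j) * (l choose j)"
          by (simp only: binomial_absorption binomial_absorb_comp)
        then show ?thesis
          using True by (metis of_nat_diff of_nat_mult)
      qed (simp add: binomial_eq_0)
      have "(a + of_nat l) * of_nat (Suc l choose k) =
         (a + of_nat l) * of_nat (l choose k) + (a + of_nat k - 1) * of_nat (l choose (k - 1))
          + of_nat k * (of_nat (l choose k) :: complex)"
        using absorb unfolding Suc by (simp add: algebra_simps)
      from arg_cong[OF this, of "\<lambda>t. t * ((- X) ^ k / pochhammer a k)"] show ?thesis
        using Suc by (simp only: if_False distrib_right add_divide_distrib times_divide_eq_right
              mult.assoc nat.distinct)
    qed simp
  qed
  then show "X * D = (a + of_nat l) * kummer_poly a (Suc l) X - (a + of_nat l - X) * kummer_poly a l X"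
    by (simp add: algebra_simps)
qed

section \<open>Generating functions of the Kummer polynomials\<close>

text \<open>
  The interchange of summation: the left-hand side is the sum of
  \<open>(a)\<^sub>m / m! w\<^sup>m D\<^sub>m (m choose l) (-y)\<^sup>l / (a)\<^sub>l\<close> over \<open>l \<le> m\<close> arranged by \<open>m\<close>, and the assumptions
  evaluate it arranged by \<open>l\<close> with \<open>m = l + i\<close>. The double series is dominated by the one in which
  \<open>(a)\<^sub>m / (a)\<^sub>l = (a+l)\<^sub>i\<close> is replaced by \<open>(\<bar>a\<bar>+l)\<^sub>i\<close>, \<open>w\<close> and \<open>y\<close> by their absolute values and \<open>D\<^sub>m\<close> by
  \<open>C r\<^sup>m\<close>; this one is summable because its inner sums are binomial series in \<open>q = \<bar>w\<bar> r < 1\<close>.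
\<close>
lemma binomial_transform_sums:
  fixes a w y S :: complex and D G :: "nat \<Rightarrow> complex"
  assumes a: "\<And>k. a + of_nat k \<noteq> 0"
    and C: "C \<ge> 0" and r: "r \<ge> 0" and wr: "norm w * r < 1"
    and D: "\<And>m. norm (D m) \<le> C * r ^ m"
    and G: "\<And>l. (\<lambda>i. pochhammer (a + of_nat l) i / fact i * w ^ i * D (i + l)) sums G l"
    and S: "(\<lambda>l. (- y * w) ^ l / fact l * G l) sums S"
  shows "(\<lambda>m. pochhammer a m / fact m * w ^ m * D m * kummer_poly a m y) sums S"
proof -
  define q where "q = norm w * r"
  have q: "0 \<le> q" "q < 1"
    using r wr by (auto simp: q_def)
  define F where "F = (\<lambda>(l, i). (- y * w) ^ l / fact l *
      (pochhammer (a + of_nat l) i / fact i * w ^ i * D (i + l)))"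
  define B where "B = (\<lambda>(l, i). C * (norm y * q) ^ l / fact l *
      (pochhammer (norm a + real l) i / fact i * q ^ i))"
  have B_row: "((\<lambda>i. B (l, i)) has_sum
      (C * (1 - q) powr (- norm a) * ((norm y * q / (1 - q)) ^ l / fact l))) UNIV" for l
  proof -
    have "(\<lambda>i. B (l, i)) sums (C * (norm y * q) ^ l / fact l * (1 - q) powr (- (norm a + real l)))"
      unfolding B_def prod.case using q by (intro sums_mult pochhammer_series_real) auto
    also have "(1 - q) powr (- (norm a + real l)) = (1 - q) powr (- norm a) / (1 - q) ^ l"
      using q by (simp add: powr_diff powr_realpow)
    finally have "(\<lambda>i. B (l, i)) sums
        (C * (1 - q) powr (- norm a) * ((norm y * q / (1 - q)) ^ l / fact l))"
      by (simp add: power_divide mult_ac)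
    then show ?thesis
      using C q by (intro sums_nonneg_imp_has_sum) (auto simp: B_def intro!: mult_nonneg_nonneg
          divide_nonneg_nonneg pochhammer_nonneg' add_nonneg_nonneg)
  qed
  have B_nonneg: "B p \<ge> 0" for p
    using C q by (auto simp: B_def split: prod.split intro!: mult_nonneg_nonneg
          divide_nonneg_nonneg pochhammer_nonneg' add_nonneg_nonneg)
  have "summable (\<lambda>l. C * (1 - q) powr (- norm a) * ((norm y * q / (1 - q)) ^ l / fact l))"
    using summable_exp[of "norm y * q / (1 - q)"] 
    by (intro summable_mult) (simp add: field_simps)
  then have "(\<lambda>l. C * (1 - q) powr (- norm a) * ((norm y * q / (1 - q)) ^ l / fact l)) summable_on UNIV"
    using C q by (subst summable_on_UNIV_nonneg_real_iff) auto
  then have B_summable: "B summable_on UNIV \<times> UNIV"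
    by (rule summable_on_SigmaI[rotated]) (use B_row B_nonneg in auto)
  have F_le: "norm (F p) \<le> B p" for p
  proof -
    obtain l i where p: "p = (l, i)" by force
    have "norm (F p) = (norm y * norm w) ^ l / fact l *
        (norm (pochhammer (a + of_nat l) i) / fact i * norm w ^ i * norm (D (i + l)))"
      by (simp add: p F_def norm_mult norm_divide norm_power)
    also have "\<dots> \<le> (norm y * norm w) ^ l / fact l *
        (pochhammer (norm a + real l) i / fact i * norm w ^ i * (C * r ^ (i + l)))"
    proof (intro mult_left_mono mult_mono divide_right_mono D)
      have "norm (pochhammer (a + of_nat l) i) \<le> pochhammer (norm (a + of_nat l)) i"
        by (rule norm_pochhammer_le)
      also have "\<dots> \<le> pochhammer (norm a + real l) i"
        by (rule pochhammer_mono_real) (auto intro: order_trans[OF norm_triangle_ineq])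
      finally show "norm (pochhammer (a + of_nat l) i) \<le> pochhammer (norm a + real l) i" .
    qed (use r in \<open>auto intro!: mult_nonneg_nonneg divide_nonneg_nonneg pochhammer_nonneg'
           add_nonneg_nonneg\<close>)
    also have "\<dots> = B p"
      by (simp add: p B_def q_def power_mult_distrib power_add mult_ac)
    finally show ?thesis .
  qed
  have "F summable_on UNIV \<times> UNIV"
    by (rule abs_summable_summable, rule Infinite_Sum.abs_summable_on_comparison_test'[OF B_summable])
      (rule F_le)
  then obtain T where T: "(F has_sum T) (UNIV \<times> UNIV)"
    by (auto simp: summable_on_def)
  have F_row: "((\<lambda>i. F (l, i)) has_sum ((- y * w) ^ l / fact l * G l)) UNIV" for l
  proof -
    have "(\<lambda>i. F (l, i)) sums ((- y * w) ^ l / fact l * G l)"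
      unfolding F_def prod.case by (intro sums_mult G)
    moreover have "(\<lambda>i. F (l, i)) summable_on UNIV"
      by (rule abs_summable_summable, rule Infinite_Sum.abs_summable_on_comparison_test')
        (use B_row[of l] F_le in \<open>auto simp: summable_on_def\<close>)
    ultimately show ?thesis
      using has_sum_imp_sums sums_unique2 summable_on_def by metis
  qed
  have "((\<lambda>l. (- y * w) ^ l / fact l * G l) has_sum T) UNIV"
    by (rule has_sum_SigmaD[OF T]) (use F_row in auto)
  then have "T = S"
    using S has_sum_imp_sums sums_unique2 by blast
  \<comment> \<open>The same family, rearranged by \<open>m = l + i\<close>.\<close>
  define H where "H = (\<lambda>(m, l). F (l, m - l))"
  have "(H has_sum S) (SIGMA m:UNIV. {..m})"
    using T \<open>T = S\<close>
    by (subst has_sum_reindex_bij_witness[where j = "\<lambda>(m, l). (l, m - l)" and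
          i = "\<lambda>(l, i). (i + l, l)" and T = "UNIV \<times> UNIV" and h = F])
       (auto simp: H_def)
  moreover have "((\<lambda>l. H (m, l)) has_sum (\<Sum>l\<le>m. H (m, l))) {..m}" for m
    by (rule has_sum_finite) auto
  ultimately have "((\<lambda>m. \<Sum>l\<le>m. H (m, l)) has_sum S) UNIV"
    by (rule has_sum_SigmaD)
  then have "(\<lambda>m. \<Sum>l\<le>m. H (m, l)) sums S"
    by (rule has_sum_imp_sums)
  moreover have "(\<Sum>l\<le>m. H (m, l)) = pochhammer a m / fact m * w ^ m * D m * kummer_poly a m y" for m
    unfolding kummer_poly_def sum_distrib_left
  proof (intro sum.cong refl)
    fix l assume "l \<in> {..m}"
    then have l: "l \<le> m" by simp
    have "pochhammer a m = pochhammer a l * pochhammer (a + of_nat l) (m - l)"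
      using l pochhammer_product by blast
    moreover have "w ^ m = w ^ l * w ^ (m - l)"
      using l by (simp flip: power_add)
    moreover have "pochhammer a l \<noteq> 0"
      by (rule pochhammer_neq_0[OF a])
    moreover have "of_nat (m choose l) = fact m / (fact l * fact (m - l) :: complex)"
      using l by (rule binomial_fact)
    moreover have "(- y * w) ^ l = (- y) ^ l * w ^ l"
      by (rule power_mult_distrib)
    ultimately show "H (m, l) = pochhammer a m / fact m * w ^ m * D m *
         (of_nat (m choose l) * (- y) ^ l / pochhammer a l)"
      using l by (simp add: H_def F_def del: mult_minus_left)
  qed
  ultimately show ?thesis
    by simp
qed

text \<open>
  For \<open>l = 0\<close> this is the interchange of summation with \<open>D = 1\<close>. The step is differentiation
  with respect to \<open>w\<close>: on the power series it multiplies by \<open>a + l\<close> and replaces \<open>l\<close> by \<open>l + 1\<close>, and on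
  the closed form it does the same by the raising relation at \<open>X/(1-w)\<close>.
\<close>
lemma kummer_poly_genfun:
  fixes a w X :: complex
  assumes a: "\<And>k. a + of_nat k \<noteq> 0" and w: "norm w < 1"
  shows "(\<lambda>i. pochhammer (a + of_nat l) i / fact i * w ^ i * kummer_poly a (i + l) X) sums
           ((1 - w) powr (- a) / (1 - w) ^ l * exp (- X * w / (1 - w)) * kummer_poly a l (X / (1 - w)))"
  using w
proof (induction l arbitrary: w)
  case 0
  have nz: "1 - w \<noteq> 0"
    using 0 by auto
  have G: "(\<lambda>i. pochhammer (a + of_nat l) i / fact i * w ^ i * 1) sums
          ((1 - w) powr (- a) / (1 - w) ^ l)" for l
    using pochhammer_series_complex[of w "a + of_nat l"] 0 nz
    by (simp add: powr_diff powr_nat)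
  have "(\<lambda>l. (1 - w) powr (- a) * ((- X * w / (1 - w)) ^ l / fact l)) sums
          ((1 - w) powr (- a) * exp (- X * w / (1 - w)))"
    by (intro sums_mult exp_sums)
  then have "(\<lambda>l. (- X * w) ^ l / fact l * ((1 - w) powr (- a) / (1 - w) ^ l)) sums
          ((1 - w) powr (- a) * exp (- X * w / (1 - w)))"
    unfolding power_divide by (simp add: mult_ac)
  from binomial_transform_sums[OF a _ _ _ _ G this, of 1 1] 0 show ?case
    by simp
next
  case (Suc l)
  define c where "c = (\<lambda>i. pochhammer (a + of_nat l) i / fact i * kummer_poly a (i + l) X)"
  define f where "f = (\<lambda>w. (1 - w) powr (- a) / (1 - w) ^ l * exp (- X * w / (1 - w)) *
                           kummer_poly a l (X / (1 - w)))"
  have nz: "1 - w \<noteq> 0"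
    using Suc.prems by auto
  have "Re (1 - w) > 0"
    using Suc.prems complex_Re_le_cmod[of w] by simp
  then have cut: "1 - w \<notin> \<real>\<^sub>\<le>\<^sub>0"
    using complex_nonpos_Reals_iff by fastforce
  have f: "(\<lambda>i. c i * v ^ i) sums f v" if "norm v < 1" for v
    using Suc.IH[OF that] by (simp add: c_def f_def mult_ac)
  define X' where "X' = X / (1 - w)"
  obtain D where D: "(kummer_poly a l has_field_derivative D) (at X')"
    "X' * D = (a + of_nat l) * kummer_poly a (Suc l) X' - (a + of_nat l - X') * kummer_poly a l X'"
    using kummer_poly_derivative[OF a] by metis
  define P where "P = (1 - w) powr (- a) / (1 - w) ^ l"
  have dP: "((\<lambda>w. (1 - w) powr (- a) / (1 - w) ^ l) has_field_derivative
      (a + of_nat l) * P / (1 - w)) (at w)"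
  proof -
    have d: "((\<lambda>w. (1 - w) powr (- a)) has_field_derivative (- a * (1 - w) powr (- a - 1)) * (- 1)) (at w)"
      by (rule DERIV_chain2[where f = "\<lambda>z. z powr (- a)" and g = "\<lambda>w. 1 - w",
            OF has_field_derivative_powr[OF cut]])
        (auto intro!: derivative_eq_intros)
    have e: "(1 - w) powr (- a - 1) = (1 - w) powr (- a) / (1 - w)"
      using nz by (simp add: powr_diff)
    have pw: "of_nat l * (1 - w) ^ (l - Suc 0) = of_nat l * (1 - w) ^ l / (1 - w)"
      using nz by (cases l) auto
    show ?thesis
      unfolding P_def e
    proof (rule DERIV_cong[OF DERIV_divide[OF d]])
      show "((\<lambda>w. (1 - w) ^ l) has_field_derivative - (of_nat l * (1 - w) ^ l / (1 - w))) (at w)"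
        by (rule derivative_eq_intros refl)+ (use pw in simp)
    qed (use nz in \<open>simp_all add: e divide_simps\<close>, simp add: algebra_simps)
  qed
  have quot: "((\<lambda>w. c * w / (1 - w)) has_field_derivative c / (1 - w)\<^sup>2) (at w)" for c
  proof -
    have "c * (1 - w) - c * w * - 1 = c"
      by (simp add: algebra_simps)
    then show ?thesis
      using nz by (auto intro!: derivative_eq_intros simp: power2_eq_square)
  qed
  have dE: "((\<lambda>w. exp (- X * w / (1 - w))) has_field_derivative
      exp (- X * w / (1 - w)) * (- X' / (1 - w))) (at w)"
    using DERIV_fun_exp[OF quot[of "- X"]] by (simp add: X'_def power2_eq_square)
  have dM: "((\<lambda>w. kummer_poly a l (X / (1 - w))) has_field_derivative D * (X' / (1 - w))) (at w)"
  proof (rule DERIV_chain2[where f = "kummer_poly a l" and g = "\<lambda>w. X / (1 - w)",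
        OF D(1)[unfolded X'_def]])
    show "((\<lambda>w. X / (1 - w)) has_field_derivative X' / (1 - w)) (at w)"
      using nz by (auto intro!: derivative_eq_intros simp: X'_def)
  qed
  have df: "(f has_field_derivative (a + of_nat l) *
      ((1 - w) powr (- a) / (1 - w) ^ Suc l * exp (- X * w / (1 - w)) * kummer_poly a (Suc l) X')) (at w)"
  proof -
    have "(f has_field_derivative
        (P * exp (- X * w / (1 - w)) * (D * (X' / (1 - w))) +
        (P * (exp (- X * w / (1 - w)) * (- X' / (1 - w))) +
           (a + of_nat l) * P / (1 - w) * exp (- X * w / (1 - w))) * kummer_poly a l X')) (at w)"
      unfolding f_def X'_def P_def
      using DERIV_mult'[OF DERIV_mult'[OF dP dE] dM] unfolding X'_def P_def .
    also have "P * exp (- X * w / (1 - w)) * (D * (X' / (1 - w))) +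
        (P * (exp (- X * w / (1 - w)) * (- X' / (1 - w))) +
           (a + of_nat l) * P / (1 - w) * exp (- X * w / (1 - w))) * kummer_poly a l X'
       = P / (1 - w) * exp (- X * w / (1 - w)) * (X' * D + (a + of_nat l - X') * kummer_poly a l X')"
      by (simp add: algebra_simps add_divide_distrib diff_divide_distrib)
    also have "\<dots> = (a + of_nat l) *
      ((1 - w) powr (- a) / (1 - w) ^ Suc l * exp (- X * w / (1 - w)) * kummer_poly a (Suc l) X')"
      unfolding D(2) P_def by (simp add: algebra_simps)
    finally show ?thesis .
  qed
  have "(\<lambda>n. diffs c n * w ^ n) sums ((a + of_nat l) *
      ((1 - w) powr (- a) / (1 - w) ^ Suc l * exp (- X * w / (1 - w)) * kummer_poly a (Suc l) X'))"
    using f df Suc.prems by (rule termdiffs_sums_strong)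
  moreover have "diffs c n * w ^ n = (a + of_nat l) *
      (pochhammer (a + of_nat (Suc l)) n / fact n * w ^ n * kummer_poly a (n + Suc l) X)" for n
  proof -
    have "pochhammer (a + of_nat l) (Suc n) = (a + of_nat l) * pochhammer (a + of_nat (Suc l)) n"
      by (simp add: pochhammer_rec add_ac)
    then show ?thesis
      by (simp add: diffs_def c_def field_simps del: of_nat_Suc)
  qed
  ultimately show ?case
    unfolding X'_def by (simp only: sums_mult_iff[OF a[of l]])
qed

text \<open>
  The hypergeometric series \<open>\<^sub>0F\<^sub>1(; a; X)\<close>.
\<close>
definition hyp_0F1 :: "complex \<Rightarrow> complex \<Rightarrow> complex" where
  "hyp_0F1 a X = (\<Sum>k. X ^ k / (fact k * pochhammer a k))"

lemma summable_hyp_0F1: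
  fixes a X :: complex
  assumes a: "\<And>k. a + of_nat k \<noteq> 0"
  shows "summable (\<lambda>k. norm (X ^ k / (fact k * pochhammer a k)))"
proof (rule summable_comparison_test'[OF summable_power_over_pochhammer[OF a, of X]])
  fix n
  have "norm (X ^ n / (fact n * pochhammer a n)) = norm (X ^ n / pochhammer a n) / fact n"
    by (simp add: norm_divide norm_mult)
  also have "\<dots> \<le> norm (X ^ n / pochhammer a n) / 1"
    by (intro divide_left_mono) auto
  finally show "norm (norm (X ^ n / (fact n * pochhammer a n))) \<le> norm (X ^ n / pochhammer a n)"
    by simp
qed

lemma hyp_0F1_sums:
  assumes a: "\<And>k. a + of_nat k \<noteq> 0"
  shows "(\<lambda>k. X ^ k / (fact k * pochhammer a k)) sums hyp_0F1 a X"
  unfolding hyp_0F1_def by (rule summable_sums, rule summable_norm_cancel, rule summable_hyp_0F1, rule a)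

lemma kummer_poly_exp_genfun:
  assumes a: "\<And>k. a + of_nat k \<noteq> 0"
  shows "(\<lambda>l. v ^ l / fact l * kummer_poly a l X) sums (exp v * hyp_0F1 a (- X * v))"
proof -
  define A where "A = (\<lambda>k. (- X * v) ^ k / (fact k * pochhammer a k))"
  have sA: "summable (\<lambda>k. norm (A k))"
    unfolding A_def by (rule summable_hyp_0F1[OF a])
  have sE: "summable (\<lambda>k. norm (v ^ k / fact k))"
    using summable_exp[of "norm v"] by (simp add: norm_divide norm_power field_simps)
  have "(\<lambda>l. \<Sum>k\<le>l. A k * (v ^ (l - k) / fact (l - k))) sums ((\<Sum>k. A k) * (\<Sum>k. v ^ k / fact k))"
    by (rule Cauchy_product_sums[OF sA sE])
  moreover have "(\<Sum>k. v ^ k / fact k) = exp v"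
    using exp_sums sums_unique by metis
  moreover have "(\<Sum>k\<le>l. A k * (v ^ (l - k) / fact (l - k))) = v ^ l / fact l * kummer_poly a l X" for l
    unfolding kummer_poly_def sum_distrib_left
  proof (intro sum.cong refl)
    fix k assume "k \<in> {..l}"
    then have k: "k \<le> l" by simp
    have "v ^ l = v ^ k * v ^ (l - k)"
      using k by (simp flip: power_add)
    moreover have "of_nat (l choose k) = fact l / (fact k * fact (l - k) :: complex)"
      using k by (rule binomial_fact)
    moreover have "(- X * v) ^ k = (- X) ^ k * v ^ k"
      by (rule power_mult_distrib)
    ultimately show "A k * (v ^ (l - k) / fact (l - k)) =
        v ^ l / fact l * (of_nat (l choose k) * (- X) ^ k / pochhammer a k)"
      by (simp add: A_def mult_ac del: mult_minus_left)
  qed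
  ultimately show ?thesis
    unfolding A_def hyp_0F1_def by (simp add: mult.commute)
qed

text \<open>
  The Hille--Hardy formula. The number \<open>\<epsilon>\<close> below is chosen so that \<open>\<bar>w\<bar> (1 + \<epsilon>) < 1\<close>.
\<close>
theorem hille_hardy:
  fixes a w X Y :: complex
  assumes a: "\<And>k. a + of_nat k \<noteq> 0" and w: "norm w < 1"
  shows "(\<lambda>m. pochhammer a m / fact m * w ^ m * kummer_poly a m X * kummer_poly a m Y) sums
           ((1 - w) powr (- a) * exp (- (X + Y) * w / (1 - w)) *
            hyp_0F1 a (X * Y * w / (1 - w)\<^sup>2))"
proof -
  define \<epsilon> where "\<epsilon> = (1 - norm w) / 2"
  have eps: "\<epsilon> > 0"
    using w by (simp add: \<epsilon>_def)
  have "norm w * (1 + \<epsilon>) < 1"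
  proof -
    have "1 - norm w * (1 + \<epsilon>) = (1 - norm w) * (2 - norm w) / 2"
      by (simp add: \<epsilon>_def field_simps)
    also have "\<dots> > 0" using w by simp
    finally show ?thesis by simp
  qed
  obtain C where C: "C \<ge> 0" "\<And>m. norm (kummer_poly a m X) \<le> C * (1 + \<epsilon>) ^ m"
    using kummer_poly_bound[OF a eps] by metis
  define E where "E = (1 - w) powr (- a) * exp (- X * w / (1 - w))"
  define v where "v = - Y * w / (1 - w)"
  define X' where "X' = X / (1 - w)"
  have "(\<lambda>l. E * (v ^ l / fact l * kummer_poly a l X')) sums
           (E * (exp v * hyp_0F1 a (- X' * v)))"
    by (intro sums_mult kummer_poly_exp_genfun a)
  also have "(\<lambda>l. E * (v ^ l / fact l * kummer_poly a l X')) =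
     (\<lambda>l. (- Y * w) ^ l / fact l * ((1 - w) powr (- a) / (1 - w) ^ l * exp (- X * w / (1 - w)) *
           kummer_poly a l (X / (1 - w))))"
    unfolding E_def v_def X'_def power_divide by (simp add: mult_ac)
  also have "- X' * v = X * Y * w / (1 - w)\<^sup>2"
    by (simp add: X'_def v_def power2_eq_square)
  also have "E * (exp v * hyp_0F1 a (X * Y * w / (1 - w)\<^sup>2))
     = (1 - w) powr (- a) * exp (- (X + Y) * w / (1 - w)) *
            hyp_0F1 a (X * Y * w / (1 - w)\<^sup>2)"
  proof -
    have "- (X + Y) * w / (1 - w) = - X * w / (1 - w) + v"
      by (simp add: v_def algebra_simps diff_divide_distrib)
    then have "exp (- (X + Y) * w / (1 - w)) = exp (- X * w / (1 - w)) * exp v"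
      by (simp only: exp_add)
    then show ?thesis
      by (simp only: E_def mult_ac)
  qed
  finally show ?thesis
    using eps \<open>norm w * (1 + \<epsilon>) < 1\<close>
    by (intro binomial_transform_sums[OF a C(1) _ _ C(2) kummer_poly_genfun[OF a w]]) auto
qed

section \<open>The constants and the Hermite polynomials in closed form\<close>

lemma C_o_neq:
  assumes "\<mu> \<in> C_o"
  shows "\<mu> + 1/2 + of_nat k \<noteq> 0"
proof
  assume "\<mu> + 1/2 + of_nat k = 0"
  then have "\<mu> = - (of_nat k + 1/2)"
    by (simp add: add_eq_0_iff2 algebra_simps)
  then show False
    using assms by (auto simp: C_o_def)
qed

lemma Gamma_ratio:
  assumes "\<And>k. (a :: complex) + of_nat k \<noteq> 0"
  shows "Gamma (of_nat m + a) / Gamma a = pochhammer a m" "Gamma a \<noteq> 0"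
proof -
  have "a \<notin> \<int>\<^sub>\<le>\<^sub>0"
  proof
    assume "a \<in> \<int>\<^sub>\<le>\<^sub>0"
    then obtain k where "a = - of_nat k"
      by (elim nonpos_Ints_cases')
    then show False
      using assms[of k] by simp
  qed
  then show "Gamma (of_nat m + a) / Gamma a = pochhammer a m" "Gamma a \<noteq> 0"
    by (auto simp: pochhammer_Gamma add.commute Gamma_eq_zero_iff)
qed

lemma gamma_mu_even:
  assumes "\<mu> \<in> C_o"
  shows "gamma_mu \<mu> (2 * m) = 4 ^ m * fact m * pochhammer (\<mu> + 1/2) m"
  using Gamma_ratio(1)[of "\<mu> + 1/2" m, OF C_o_neq[OF assms]]
  by (simp add: gamma_mu_def power_mult add_ac flip: times_divide_eq_right)

lemma gamma_mu_odd:
  assumes "\<mu> \<in> C_o"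
  shows "gamma_mu \<mu> (2 * m + 1) = 2 * 4 ^ m * fact m * pochhammer (\<mu> + 1/2) (m + 1)"
proof -
  have "of_nat (m + 1) + (\<mu> + 1/2) = of_nat m + \<mu> + 3/2"
    by simp
  then have "Gamma (of_nat m + \<mu> + 3/2) / Gamma (\<mu> + 1/2) = pochhammer (\<mu> + 1/2) (m + 1)"
    using Gamma_ratio(1)[of "\<mu> + 1/2" "m + 1", OF C_o_neq[OF assms]] by metis
  then show ?thesis
    by (simp add: gamma_mu_def power_mult flip: times_divide_eq_right)
qed

lemma gamma_mu_Suc:
  assumes "\<mu> \<in> C_o"
  shows "gamma_mu \<mu> (Suc n) = (of_nat (Suc n) + 2 * \<mu> * theta (Suc n)) * gamma_mu \<mu> n"
proof (cases "even n")
  case True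
  then obtain m where n: "n = 2 * m" by blast
  show ?thesis
    using gamma_mu_even[OF assms, of m] gamma_mu_odd[OF assms, of m]
    by (simp add: n theta_def pochhammer_Suc algebra_simps)
next
  case False
  then obtain m where n: "n = 2 * m + 1" using oddE by blast
  show ?thesis
    using gamma_mu_even[OF assms, of "Suc m"] gamma_mu_odd[OF assms, of m]
    by (simp add: n theta_def pochhammer_Suc algebra_simps)
qed

lemma gamma_mu_nonzero:
  assumes "\<mu> \<in> C_o"
  shows "gamma_mu \<mu> n \<noteq> 0"
proof (cases "even n")
  case True
  then obtain m where n: "n = 2 * m" by blast
  show ?thesis
    unfolding n gamma_mu_even[OF assms] using pochhammer_neq_0[OF C_o_neq[OF assms]] by simp
next
  case False
  then obtain m where n: "n = 2 * m + 1" using oddE by blast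
  show ?thesis
    unfolding n gamma_mu_odd[OF assms] using pochhammer_neq_0[OF C_o_neq[OF assms]] by simp
qed

lemma gamma_mu_0 [simp]: "\<mu> \<in> C_o \<Longrightarrow> gamma_mu \<mu> 0 = 1"
  using gamma_mu_even[of \<mu> 0] by simp

lemma gen_hermite_even:
  assumes "\<mu> \<in> C_o"
  shows "gen_hermite \<mu> (int (2 * m)) x
           = (-1) ^ m * (fact (2 * m) / fact m) * kummer_poly (\<mu> + 1/2) m (x\<^sup>2)"
proof -
  define a where "a = \<mu> + 1/2"
  have a: "a + of_nat k \<noteq> 0" for k
    unfolding a_def by (rule C_o_neq[OF assms])
  have "Gamma a / Gamma (of_nat k + \<mu> + 1/2) = 1 / pochhammer a k" for k
  proof -
    have e: "of_nat k + \<mu> + 1/2 = of_nat k + a" by (simp add: a_def)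
    show ?thesis
      unfolding e Gamma_ratio(1)[OF a, symmetric] by simp
  qed
  moreover have "nat (int (2 * m)) div 2 = m" by simp
  ultimately show ?thesis
    unfolding gen_hermite_def Let_def kummer_poly_def a_def[symmetric]
    by (simp add: power_minus[of "x\<^sup>2"] power_mult) (simp add: mult_ac)
qed

lemma gen_hermite_odd:
  assumes "\<mu> \<in> C_o"
  shows "gen_hermite \<mu> (int (2 * m + 1)) x
           = (-1) ^ m * (fact (2 * m + 1) / fact m) * (x / (\<mu> + 1/2)) * kummer_poly (\<mu> + 3/2) m (x\<^sup>2)"
proof -
  define a where "a = \<mu> + 1/2"
  have a: "a + of_nat k \<noteq> 0" for k
    unfolding a_def by (rule C_o_neq[OF assms])
  have a1: "\<mu> + 3/2 = a + 1" by (simp add: a_def)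
  have "Gamma a / Gamma (of_nat k + \<mu> + 3/2) = 1 / (a * pochhammer (a + 1) k)" for k
  proof -
    have e: "of_nat k + \<mu> + 3/2 = of_nat (Suc k) + a" by (simp add: a_def)
    show ?thesis
      unfolding e pochhammer_rec[symmetric] Gamma_ratio(1)[OF a, symmetric] by simp
  qed
  moreover have "nat (int (2 * m + 1)) div 2 = m" by simp
  ultimately show ?thesis
    unfolding gen_hermite_def Let_def kummer_poly_def a_def[symmetric] a1
    by (simp add: power_minus[of "x\<^sup>2"] power_mult sum_distrib_left sum_divide_distrib del: fact_Suc)
       (simp add: mult_ac del: fact_Suc)
qed

text \<open>
  The closed form with the order of summation reversed, which makes it uniform in the parity of \<open>n\<close>.
\<close>
lemma gen_hermite_expansion:
  assumes "\<mu> \<in> C_o"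
  shows "gen_hermite \<mu> (int n) x / fact n
           = (\<Sum>k\<le>n div 2. (-1) ^ k / fact k * ((2 * x) ^ (n - 2 * k) / gamma_mu \<mu> (n - 2 * k)))"
proof -
  define a where "a = \<mu> + 1/2"
  have a1: "\<mu> + 3/2 = a + 1" by (simp add: a_def)
  have coeff: "(-1) ^ m * of_nat (m choose k) * (- X) ^ k / fact m
      = (-1) ^ (m - k) / fact (m - k) * (X ^ k / fact k)" if "k \<le> m" for m k and X :: complex
  proof -
    have "(-1 :: complex) ^ m = (-1) ^ (m - k) * (-1) ^ k"
      using that by (simp flip: power_add)
    then show ?thesis
      using that by (simp add: binomial_fact power_minus[of X])
  qed
  show ?thesis
  proof (cases "even n")
    case True
    then obtain m where n: "n = 2 * m" by blast
    have "gen_hermite \<mu> (int n) x / fact n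
      = (\<Sum>k\<le>m. (-1) ^ (m - k) / fact (m - k) * ((x\<^sup>2) ^ k / fact k) / pochhammer a k)"
      unfolding n gen_hermite_even[OF assms] kummer_poly_def a_def[symmetric]
      unfolding sum_distrib_left sum_divide_distrib
    proof (intro sum.cong refl)
      fix k assume "k \<in> {..m}"
      then have "(-1) ^ m * of_nat (m choose k) * (- x\<^sup>2) ^ k / fact m * (1 / pochhammer a k)
          = (-1) ^ (m - k) / fact (m - k) * ((x\<^sup>2) ^ k / fact k) * (1 / pochhammer a k)"
        using coeff[of k m "x\<^sup>2"] by (simp only: atMost_iff)
      then show "(-1) ^ m * (fact (2 * m) / fact m) * (of_nat (m choose k) * (- x\<^sup>2) ^ k / pochhammer a k)
          / fact (2 * m) = (-1) ^ (m - k) / fact (m - k) * ((x\<^sup>2) ^ k / fact k) / pochhammer a k"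
        by (simp add: mult_ac)
    qed
    \<comment> \<open>Reverse the order of summation, \<open>k\<close> to \<open>m - k\<close>.\<close>
    also have "\<dots> = (\<Sum>k\<le>m. (-1) ^ k / fact k * ((x\<^sup>2) ^ (m - k) / fact (m - k)) / pochhammer a (m - k))"
      by (subst sum.nat_diff_reindex[symmetric, of _ "Suc m", unfolded lessThan_Suc_atMost])
        (auto intro!: sum.cong)
    also have "\<dots> = (\<Sum>k\<le>m. (-1) ^ k / fact k * ((2 * x) ^ (n - 2 * k) / gamma_mu \<mu> (n - 2 * k)))"
    proof (intro sum.cong refl)
      fix k
      have e: "n - 2 * k = 2 * (m - k)" by (simp add: n)
      show "(-1) ^ k / fact k * ((x\<^sup>2) ^ (m - k) / fact (m - k)) / pochhammer a (m - k)
        = (-1) ^ k / fact k * ((2 * x) ^ (n - 2 * k) / gamma_mu \<mu> (n - 2 * k))"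
        unfolding e gamma_mu_even[OF assms] a_def[symmetric]
        by (simp add: power_mult power_mult_distrib)
    qed
    finally show ?thesis by (simp add: n)
  next
    case False
    then obtain m where n: "n = 2 * m + 1" using oddE by blast
    have "gen_hermite \<mu> (int n) x / fact n
      = (\<Sum>k\<le>m. (-1) ^ (m - k) / fact (m - k) * ((x\<^sup>2) ^ k / fact k) * x / (a * pochhammer (a + 1) k))"
      unfolding n gen_hermite_odd[OF assms] kummer_poly_def a_def[symmetric] a1
      unfolding sum_distrib_left sum_divide_distrib
    proof (intro sum.cong refl)
      fix k assume "k \<in> {..m}"
      then have "(-1) ^ m * of_nat (m choose k) * (- x\<^sup>2) ^ k / fact m * (x / (a * pochhammer (a + 1) k))
          = (-1) ^ (m - k) / fact (m - k) * ((x\<^sup>2) ^ k / fact k) * (x / (a * pochhammer (a + 1) k))"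
        using coeff[of k m "x\<^sup>2"] by (simp only: atMost_iff)
      then show "(-1) ^ m * (fact (2 * m + 1) / fact m) * (x / a) *
            (of_nat (m choose k) * (- x\<^sup>2) ^ k / pochhammer (a + 1) k) / fact (2 * m + 1)
          = (-1) ^ (m - k) / fact (m - k) * ((x\<^sup>2) ^ k / fact k) * x / (a * pochhammer (a + 1) k)"
        by (simp add: mult_ac del: fact_Suc)
    qed
    also have "\<dots> = (\<Sum>k\<le>m. (-1) ^ k / fact k * ((x\<^sup>2) ^ (m - k) / fact (m - k)) * x / (a * pochhammer (a + 1) (m - k)))"
      by (subst sum.nat_diff_reindex[symmetric, of _ "Suc m", unfolded lessThan_Suc_atMost])
        (auto intro!: sum.cong)
    also have "\<dots> = (\<Sum>k\<le>m. (-1) ^ k / fact k * ((2 * x) ^ (n - 2 * k) / gamma_mu \<mu> (n - 2 * k)))"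
    proof (intro sum.cong refl)
      fix k assume "k \<in> {..m}"
      then have e: "n - 2 * k = 2 * (m - k) + 1" by (simp add: n)
      show "(-1) ^ k / fact k * ((x\<^sup>2) ^ (m - k) / fact (m - k)) * x / (a * pochhammer (a + 1) (m - k))
        = (-1) ^ k / fact k * ((2 * x) ^ (n - 2 * k) / gamma_mu \<mu> (n - 2 * k))"
        unfolding e gamma_mu_odd[OF assms] a_def[symmetric]
        by (simp add: power_mult power_mult_distrib power_add pochhammer_rec) (simp add: mult_ac)
    qed
    finally show ?thesis by (simp add: n)
  qed
qed

section \<open>Inversion formula and three term recursion\<close>

text \<open>
  The formal series of \<open>H\<^sub>n(x) / n!\<close> over the indices \<open>n = 2m + r\<close> of one parity \<open>r\<close>.
\<close>
definition hermite_fps :: "complex \<Rightarrow> complex \<Rightarrow> nat \<Rightarrow> complex fps" where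
  "hermite_fps \<mu> x r = Abs_fps (\<lambda>m. gen_hermite \<mu> (int (2 * m + r)) x / fact (2 * m + r))"

text \<open>
  The formal series of \<open>(2x)\<^sup>n / \<gamma>(n)\<close> over the indices \<open>n = 2m + r\<close> of one parity \<open>r\<close>.
\<close>
definition monomial_fps :: "complex \<Rightarrow> complex \<Rightarrow> nat \<Rightarrow> complex fps" where
  "monomial_fps \<mu> x r = Abs_fps (\<lambda>m. (2 * x) ^ (2 * m + r) / gamma_mu \<mu> (2 * m + r))"

lemma hermite_fps_eq:
  assumes "\<mu> \<in> C_o" "r < 2"
  shows "hermite_fps \<mu> x r = fps_exp (-1) * monomial_fps \<mu> x r"
proof (rule fps_ext)
  fix m
  have "(2 * m + r) div 2 = m" using assms(2) by simp
  moreover have "2 * m + r - 2 * k = 2 * (m - k) + r" if "k \<in> {..m}" for k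
    using that by simp
  ultimately show "fps_nth (hermite_fps \<mu> x r) m = fps_nth (fps_exp (-1) * monomial_fps \<mu> x r) m"
    by (simp add: hermite_fps_def monomial_fps_def fps_mult_nth gen_hermite_expansion[OF assms(1)]
        atLeast0AtMost del: of_nat_add of_nat_mult atMost_iff cong: sum.cong)
qed

lemma gen_hermite_inversion:
  assumes "\<mu> \<in> C_o"
  shows "(2 * x) ^ n / gamma_mu \<mu> n
           = (\<Sum>k = 0..n div 2. gen_hermite \<mu> (int (n - 2 * k)) x / (fact k * fact (n - 2 * k)))"
proof -
  define m r where "m = n div 2" and "r = n mod 2"
  have n: "n = 2 * m + r" by (simp add: m_def r_def)
  have "r < 2" by (simp add: r_def)
  have "fps_exp 1 * hermite_fps \<mu> x r = monomial_fps \<mu> x r"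
    unfolding hermite_fps_eq[OF assms \<open>r < 2\<close>] mult.assoc[symmetric] fps_exp_add_mult[symmetric]
    by simp
  then have "(2 * x) ^ n / gamma_mu \<mu> n = fps_nth (fps_exp 1 * hermite_fps \<mu> x r) m"
    by (simp add: monomial_fps_def n)
  also have "\<dots> = (\<Sum>k = 0..m. gen_hermite \<mu> (int (n - 2 * k)) x / (fact k * fact (n - 2 * k)))"
    unfolding fps_mult_nth
  proof (intro sum.cong refl)
    fix k assume "k \<in> {0..m}"
    then have "n - 2 * k = 2 * (m - k) + r" by (simp add: n)
    then show "fps_nth (fps_exp 1) k * fps_nth (hermite_fps \<mu> x r) (m - k)
      = gen_hermite \<mu> (int (n - 2 * k)) x / (fact k * fact (n - 2 * k))"
      by (simp add: hermite_fps_def)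
  qed
  finally show ?thesis by (simp add: m_def)
qed

text \<open>
  The three term recursion as a pair of differential relations between the two formal series. They
  are obtained from the corresponding relations \<open>m0\<close> and \<open>m1\<close> for the monomials, which merely encode
  \<open>\<gamma>(n+1) = (n + 1 + 2\<mu>\<theta>\<^bsub>n+1\<^esub>) \<gamma>(n)\<close>, by multiplying with \<open>exp (-X)\<close>.
\<close>
lemma gen_hermite_fps_recursion:
  assumes "\<mu> \<in> C_o"
  shows "fps_const (2 * x) * hermite_fps \<mu> x 0
     = fps_const (1 + 2 * \<mu>) * hermite_fps \<mu> x 1
       + 2 * fps_X * (fps_deriv (hermite_fps \<mu> x 1) + hermite_fps \<mu> x 1)" (is ?even)
    and "fps_const (2 * x) * hermite_fps \<mu> x 1
     = 2 * (fps_deriv (hermite_fps \<mu> x 0) + hermite_fps \<mu> x 0)" (is ?odd)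
proof -
  have nz: "gamma_mu \<mu> k \<noteq> 0" for k
    by (rule gamma_mu_nonzero[OF assms])
  have m0: "fps_const (2 * x) * monomial_fps \<mu> x 0
    = fps_const (1 + 2 * \<mu>) * monomial_fps \<mu> x 1 + 2 * fps_X * fps_deriv (monomial_fps \<mu> x 1)"
  proof (rule fps_ext)
    fix m
    have g: "gamma_mu \<mu> (Suc (2 * m)) = (of_nat (Suc (2 * m)) + 2 * \<mu>) * gamma_mu \<mu> (2 * m)"
      using gamma_mu_Suc[OF assms, of "2 * m"] by (simp add: theta_def)
    have "fps_nth (2 * fps_X * fps_deriv (monomial_fps \<mu> x 1)) m
      = 2 * of_nat m * fps_nth (monomial_fps \<mu> x 1) m"
      by (cases m) (simp_all add: mult.assoc numeral_fps_const)
    moreover have "2 * x * fps_nth (monomial_fps \<mu> x 0) m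
      = (1 + 2 * \<mu> + 2 * of_nat m) * fps_nth (monomial_fps \<mu> x 1) m"
      using nz[of "Suc (2 * m)"] nz[of "2 * m"] unfolding monomial_fps_def fps_nth_Abs_fps
      by (simp add: g divide_simps)
    ultimately show "fps_nth (fps_const (2 * x) * monomial_fps \<mu> x 0) m
      = fps_nth (fps_const (1 + 2 * \<mu>) * monomial_fps \<mu> x 1
                   + 2 * fps_X * fps_deriv (monomial_fps \<mu> x 1)) m"
      by (simp add: algebra_simps)
  qed
  have m1: "fps_const (2 * x) * monomial_fps \<mu> x 1 = 2 * fps_deriv (monomial_fps \<mu> x 0)"
  proof (rule fps_ext)
    fix m
    have g: "gamma_mu \<mu> (Suc (Suc (2 * m))) = of_nat (Suc (Suc (2 * m))) * gamma_mu \<mu> (Suc (2 * m))"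
      using gamma_mu_Suc[OF assms, of "Suc (2 * m)"] by (simp add: theta_def)
    show "fps_nth (fps_const (2 * x) * monomial_fps \<mu> x 1) m = fps_nth (2 * fps_deriv (monomial_fps \<mu> x 0)) m"
      using nz[of "Suc (2 * m)"] nz[of "Suc (Suc (2 * m))"]
      by (simp add: monomial_fps_def g numeral_fps_const divide_simps del: of_nat_Suc)
         (simp add: algebra_simps)
  qed
  have neg: "fps_const (-1 :: complex) = -1"
    by (simp flip: fps_const_neg)
  show ?even
    using arg_cong[OF m0, of "\<lambda>F. fps_exp (-1) * F"]
    by (simp add: hermite_fps_eq[OF assms] neg algebra_simps)
  show ?odd
    using arg_cong[OF m1, of "\<lambda>F. fps_exp (-1) * F"]
    by (simp add: hermite_fps_eq[OF assms] neg algebra_simps)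
qed

lemma gen_hermite_recursion:
  assumes "\<mu> \<in> C_o"
  shows "2 * of_nat n * gen_hermite \<mu> (int n - 1) x
           + (1 + 2 * \<mu> * theta (n + 1) / of_nat (n + 1)) * gen_hermite \<mu> (int n + 1) x
         = 2 * x * gen_hermite \<mu> (int n) x"
proof (cases "even n")
  case True
  then obtain m where n: "n = 2 * m" by blast
  define h where "h = fps_nth (hermite_fps \<mu> x 1)"
  have nth: "2 * x * fps_nth (hermite_fps \<mu> x 0) m
      = (1 + 2 * \<mu> + 2 * of_nat m) * h m + (if m = 0 then 0 else 2 * h (m - 1))"
    using arg_cong[OF gen_hermite_fps_recursion(1)[OF assms, of x], of "\<lambda>F. fps_nth F m"]
    by (cases m) (simp_all add: h_def mult.assoc numeral_fps_const algebra_simps)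
  have h0: "fps_nth (hermite_fps \<mu> x 0) m = gen_hermite \<mu> (int n) x / fact n"
    by (simp add: hermite_fps_def n)
  have e: "int n + 1 = int (2 * m + 1)" by (simp add: n)
  have h1: "h m = gen_hermite \<mu> (int n + 1) x / fact (n + 1)"
    unfolding e h_def hermite_fps_def fps_nth_Abs_fps by (simp only: n)
  have h2: "(if m = 0 then 0 else 2 * h (m - 1)) = 2 * of_nat n * gen_hermite \<mu> (int n - 1) x / fact n"
  proof (cases m)
    case (Suc j)
    have e: "int n - 1 = int (2 * j + 1)" by (simp add: n Suc)
    have f: "fact n = of_nat n * (fact (2 * j + 1) :: complex)"
      by (simp add: n Suc algebra_simps)
    have "of_nat n \<noteq> (0 :: complex)" unfolding of_nat_eq_0_iff by (simp add: n Suc)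
    then show ?thesis
      unfolding e f h_def hermite_fps_def fps_nth_Abs_fps by (simp add: Suc del: fact_Suc)
  qed (simp add: n)
  have f: "fact (n + 1) = of_nat (n + 1) * (fact n :: complex)" by simp
  have "of_nat (n + 1) \<noteq> (0 :: complex)" unfolding of_nat_eq_0_iff by simp
  have t: "(1 + 2 * \<mu> * theta (n + 1) / of_nat (n + 1)) = (1 + 2 * \<mu> + 2 * of_nat m) / of_nat (n + 1)"
    using \<open>of_nat (n + 1) \<noteq> (0 :: complex)\<close> by (simp add: theta_def n field_simps)
  show ?thesis
    using nth unfolding h0 h1 h2 f t using \<open>of_nat (n + 1) \<noteq> (0 :: complex)\<close>
    by (simp add: divide_simps del: of_nat_add of_nat_Suc) (simp add: algebra_simps)
next
  case False
  then obtain m where n: "n = 2 * m + 1" using oddE by blast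
  define h where "h = fps_nth (hermite_fps \<mu> x 0)"
  have nth: "2 * x * fps_nth (hermite_fps \<mu> x 1) m = 2 * of_nat (Suc m) * h (Suc m) + 2 * h m"
    using arg_cong[OF gen_hermite_fps_recursion(2)[OF assms, of x], of "\<lambda>F. fps_nth F m"]
    by (simp add: h_def numeral_fps_const algebra_simps)
  have h0: "fps_nth (hermite_fps \<mu> x 1) m = gen_hermite \<mu> (int n) x / fact n"
    unfolding hermite_fps_def fps_nth_Abs_fps by (simp only: n)
  have e: "int n + 1 = int (2 * Suc m + 0)" and k: "n + 1 = 2 * Suc m + 0" by (simp_all add: n)
  have h1: "h (Suc m) = gen_hermite \<mu> (int n + 1) x / fact (n + 1)"
    unfolding e k h_def hermite_fps_def fps_nth_Abs_fps ..
  have e: "int n - 1 = int (2 * m + 0)" by (simp add: n)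
  have f: "fact n = of_nat n * (fact (2 * m + 0) :: complex)" by (simp add: n)
  have "of_nat n \<noteq> (0 :: complex)" unfolding of_nat_eq_0_iff by (simp add: n)
  then have h2: "h m = of_nat n * gen_hermite \<mu> (int n - 1) x / fact n"
    unfolding e f h_def hermite_fps_def fps_nth_Abs_fps by simp
  have f: "fact (n + 1) = of_nat (n + 1) * (fact n :: complex)" by simp
  have t: "2 * of_nat (Suc m) = (of_nat (n + 1) :: complex)" by (simp add: n)
  have "of_nat (n + 1) \<noteq> (0 :: complex)" unfolding of_nat_eq_0_iff by simp
  moreover have "theta (n + 1) = 0" by (simp add: theta_def n)
  ultimately show ?thesis
    using nth unfolding h0 h1 h2 f t
    by (simp add: divide_simps del: of_nat_add of_nat_Suc)
qed

section \<open>The Dunkl operator\<close>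

text \<open>
  \<open>has_dunkl \<mu> \<phi> g\<close> states that \<open>\<phi>\<close> is entire and \<open>\<DD>\<phi> = g\<close>, without a case distinction at the
  origin: \<open>\<psi>\<close> is the continuous extension of the difference quotient \<open>(\<phi>(t) - \<phi>(-t)) / t\<close>, so that
  \<open>\<phi>' = g - \<mu>\<psi>\<close>. In this form the rules of calculus below need no treatment of the singularity.
\<close>
definition has_dunkl :: "complex \<Rightarrow> (complex \<Rightarrow> complex) \<Rightarrow> (complex \<Rightarrow> complex) \<Rightarrow> bool" where
  "has_dunkl \<mu> \<phi> g \<longleftrightarrow> (\<exists>\<psi>. (\<forall>t. \<phi> t - \<phi> (- t) = t * \<psi> t) \<and> continuous_on UNIV \<psi> \<and>
      (\<forall>t. (\<phi> has_field_derivative (g t - \<mu> * \<psi> t)) (at t)))"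

lemma has_dunklI:
  assumes "\<And>t. \<phi> t - \<phi> (- t) = t * \<psi> t" "continuous_on UNIV \<psi>"
    "\<And>t. (\<phi> has_field_derivative (g t - \<mu> * \<psi> t)) (at t)"
  shows "has_dunkl \<mu> \<phi> g"
  using assms unfolding has_dunkl_def by blast

lemma has_dunkl_imp_dunkl:
  assumes "has_dunkl \<mu> \<phi> g"
  shows "dunkl \<mu> \<phi> = g"
proof
  fix x
  obtain \<psi> where \<psi>: "\<And>t. \<phi> t - \<phi> (- t) = t * \<psi> t" "continuous_on UNIV \<psi>"
      "\<And>t. (\<phi> has_field_derivative (g t - \<mu> * \<psi> t)) (at t)"
    using assms unfolding has_dunkl_def by blast
  have "(\<lambda>t. \<mu> * \<psi> t) \<midarrow>x\<rightarrow> \<mu> * \<psi> x"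
    using \<psi>(2) by (intro tendsto_intros) (auto simp: continuous_on_eq_continuous_at isCont_def)
  then have "(\<lambda>t. \<mu> / t * (\<phi> t - \<phi> (- t))) \<midarrow>x\<rightarrow> \<mu> * \<psi> x"
  proof (rule Lim_transform_eventually)
    have "eventually (\<lambda>t. t \<noteq> 0) (at x)"
      by (rule eventually_neq_at_within)
    then show "\<forall>\<^sub>F t in at x. \<mu> * \<psi> t = \<mu> / t * (\<phi> t - \<phi> (- t))"
      by eventually_elim (simp add: \<psi>(1))
  qed
  then have "remove_sings (\<lambda>t. \<mu> / t * (\<phi> t - \<phi> (- t))) x = \<mu> * \<psi> x"
    by (rule remove_sings_eqI)
  then show "dunkl \<mu> \<phi> x = g x"
    by (simp add: dunkl_def DERIV_imp_deriv[OF \<psi>(3)])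
qed

lemma has_dunkl_zero: "has_dunkl \<mu> (\<lambda>t. 0) (\<lambda>t. 0)"
  by (rule has_dunklI[where \<psi> = "\<lambda>_. 0"]) auto

lemma has_dunkl_add:
  assumes "has_dunkl \<mu> \<phi> g" "has_dunkl \<mu> \<phi>' g'"
  shows "has_dunkl \<mu> (\<lambda>t. \<phi> t + \<phi>' t) (\<lambda>t. g t + g' t)"
proof -
  obtain \<psi> \<psi>' where p: "\<And>t. \<phi> t - \<phi> (- t) = t * \<psi> t" "continuous_on UNIV \<psi>"
      "\<And>t. (\<phi> has_field_derivative (g t - \<mu> * \<psi> t)) (at t)"
      "\<And>t. \<phi>' t - \<phi>' (- t) = t * \<psi>' t" "continuous_on UNIV \<psi>'"
      "\<And>t. (\<phi>' has_field_derivative (g' t - \<mu> * \<psi>' t)) (at t)"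
    using assms unfolding has_dunkl_def by blast
  show ?thesis
  proof (rule has_dunklI[where \<psi> = "\<lambda>t. \<psi> t + \<psi>' t"])
    show "\<phi> t + \<phi>' t - (\<phi> (- t) + \<phi>' (- t)) = t * (\<psi> t + \<psi>' t)" for t
      using p(1,4)[of t] by (simp add: algebra_simps)
    show "((\<lambda>t. \<phi> t + \<phi>' t) has_field_derivative g t + g' t - \<mu> * (\<psi> t + \<psi>' t)) (at t)" for t
      using DERIV_add[OF p(3) p(6)] by (simp add: algebra_simps)
  qed (intro continuous_intros p)
qed

lemma has_dunkl_cmult:
  assumes "has_dunkl \<mu> \<phi> g"
  shows "has_dunkl \<mu> (\<lambda>t. c * \<phi> t) (\<lambda>t. c * g t)"
proof -
  obtain \<psi> where p: "\<And>t. \<phi> t - \<phi> (- t) = t * \<psi> t" "continuous_on UNIV \<psi>"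
      "\<And>t. (\<phi> has_field_derivative (g t - \<mu> * \<psi> t)) (at t)"
    using assms unfolding has_dunkl_def by blast
  show ?thesis
  proof (rule has_dunklI[where \<psi> = "\<lambda>t. c * \<psi> t"])
    show "c * \<phi> t - c * \<phi> (- t) = t * (c * \<psi> t)" for t
      using p(1)[of t] by (metis right_diff_distrib mult.left_commute)
    show "((\<lambda>t. c * \<phi> t) has_field_derivative c * g t - \<mu> * (c * \<psi> t)) (at t)" for t
      using DERIV_cmult[OF p(3), of c] by (simp add: algebra_simps)
  qed (intro continuous_intros p)
qed

lemma has_dunkl_sum:
  assumes "\<And>k. k \<in> A \<Longrightarrow> has_dunkl \<mu> (\<phi> k) (g k)"
  shows "has_dunkl \<mu> (\<lambda>t. \<Sum>k\<in>A. \<phi> k t) (\<lambda>t. \<Sum>k\<in>A. g k t)"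
  using assms by (induction A rule: infinite_finite_induct) (auto intro: has_dunkl_zero has_dunkl_add)

lemma has_dunkl_scale:
  assumes "has_dunkl \<mu> \<phi> g"
  shows "has_dunkl \<mu> (\<lambda>t. \<phi> (c * t)) (\<lambda>t. c * g (c * t))"
proof -
  obtain \<psi> where p: "\<And>t. \<phi> t - \<phi> (- t) = t * \<psi> t" "continuous_on UNIV \<psi>"
      "\<And>t. (\<phi> has_field_derivative (g t - \<mu> * \<psi> t)) (at t)"
    using assms unfolding has_dunkl_def by blast
  show ?thesis
  proof (rule has_dunklI[where \<psi> = "\<lambda>t. c * \<psi> (c * t)"])
    show "\<phi> (c * t) - \<phi> (c * - t) = t * (c * \<psi> (c * t))" for t
      using p(1)[of "c * t"] by simp
    show "((\<lambda>t. \<phi> (c * t)) has_field_derivative c * g (c * t) - \<mu> * (c * \<psi> (c * t))) (at t)" for t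
      by (rule DERIV_chain2[OF p(3), THEN DERIV_cong])
        (auto intro!: derivative_eq_intros simp: algebra_simps)
    show "continuous_on UNIV (\<lambda>t. c * \<psi> (c * t))"
      by (intro continuous_intros continuous_on_compose2[OF p(2)]) auto
  qed
qed

text \<open>
  The product rule for an even factor \<open>f\<close>, on which \<open>\<DD>\<close> is the ordinary derivative. Without evenness
  the rule fails in general.
\<close>
lemma has_dunkl_even_mult:
  assumes "has_dunkl \<mu> \<phi> g" "\<And>t. f (- t) = f t" "\<And>t. (f has_field_derivative f' t) (at t)"
  shows "has_dunkl \<mu> (\<lambda>t. f t * \<phi> t) (\<lambda>t. f' t * \<phi> t + f t * g t)"
proof -
  obtain \<psi> where p: "\<And>t. \<phi> t - \<phi> (- t) = t * \<psi> t" "continuous_on UNIV \<psi>"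
      "\<And>t. (\<phi> has_field_derivative (g t - \<mu> * \<psi> t)) (at t)"
    using assms unfolding has_dunkl_def by blast
  have cf: "continuous_on UNIV f"
    using assms(3) DERIV_continuous_on DERIV_subset by blast
  show ?thesis
  proof (rule has_dunklI[where \<psi> = "\<lambda>t. f t * \<psi> t"])
    show "f t * \<phi> t - f (- t) * \<phi> (- t) = t * (f t * \<psi> t)" for t
      using p(1)[of t] unfolding assms(2) by (metis right_diff_distrib mult.left_commute)
    show "((\<lambda>t. f t * \<phi> t) has_field_derivative f' t * \<phi> t + f t * g t - \<mu> * (f t * \<psi> t)) (at t)" for t
      using DERIV_mult'[OF assms(3) p(3)] by (simp add: algebra_simps)
  qed (intro continuous_intros p cf)
qed

lemma has_dunkl_power:
  "has_dunkl \<mu> (\<lambda>t. t ^ n) (\<lambda>t. (of_nat n + 2 * \<mu> * theta n) * t ^ (n - 1))"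
proof (rule has_dunklI[where \<psi> = "\<lambda>t. 2 * theta n * t ^ (n - 1)"])
  show "t ^ n - (- t) ^ n = t * (2 * theta n * t ^ (n - 1))" for t :: complex
    by (cases n) (auto simp: theta_def)
  show "((\<lambda>t. t ^ n) has_field_derivative
      (of_nat n + 2 * \<mu> * theta n) * t ^ (n - 1) - \<mu> * (2 * theta n * t ^ (n - 1))) (at t)" for t
    by (rule derivative_eq_intros refl)+ (simp add: algebra_simps)
qed (intro continuous_intros)

lemma has_dunkl_gen_hermite:
  assumes "\<mu> \<in> C_o"
  shows "has_dunkl \<mu> (gen_hermite \<mu> (int n)) (\<lambda>t. 2 * of_nat n * gen_hermite \<mu> (int n - 1) t)"
proof -
  have nz: "gamma_mu \<mu> k \<noteq> 0" for k
    by (rule gamma_mu_nonzero[OF assms])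
  define u where "u = (\<lambda>j t. (2 * t) ^ j / gamma_mu \<mu> j)"
  define u' where "u' = (\<lambda>j t. if j = 0 then 0 else 2 * u (j - 1) t)"
  have H: "gen_hermite \<mu> (int n) x = fact n * (\<Sum>k\<le>n div 2. (-1) ^ k / fact k * u (n - 2 * k) x)" for n x
    using gen_hermite_expansion[OF assms, of n x] unfolding u_def by (simp add: divide_eq_eq mult.commute)
  have u: "has_dunkl \<mu> (u j) (u' j)" for j
  proof -
    have "has_dunkl \<mu> (\<lambda>t. 2 ^ j / gamma_mu \<mu> j * t ^ j)
        (\<lambda>t. 2 ^ j / gamma_mu \<mu> j * ((of_nat j + 2 * \<mu> * theta j) * t ^ (j - 1)))"
      by (intro has_dunkl_cmult has_dunkl_power)
    moreover have "2 ^ j / gamma_mu \<mu> j * ((of_nat j + 2 * \<mu> * theta j) * t ^ (j - 1)) = u' j t" for t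
    proof (cases j)
      case (Suc i)
      have "of_nat (Suc i) + 2 * \<mu> * theta (Suc i) \<noteq> 0"
        using nz[of "Suc i"] unfolding gamma_mu_Suc[OF assms] by auto
      then show ?thesis
        unfolding Suc gamma_mu_Suc[OF assms] u'_def u_def
        by (simp add: power_mult_distrib del: of_nat_Suc)
    qed (simp add: u'_def theta_def)
    ultimately show ?thesis
      by (simp add: u_def power_mult_distrib)
  qed
  have "has_dunkl \<mu> (\<lambda>t. fact n * (\<Sum>k\<le>n div 2. (-1) ^ k / fact k * u (n - 2 * k) t))
      (\<lambda>t. fact n * (\<Sum>k\<le>n div 2. (-1) ^ k / fact k * u' (n - 2 * k) t))"
    by (intro has_dunkl_cmult has_dunkl_sum u)
  moreover have "fact n * (\<Sum>k\<le>n div 2. (-1) ^ k / fact k * u' (n - 2 * k) t)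
      = 2 * of_nat n * gen_hermite \<mu> (int n - 1) t" for t
  proof (cases n)
    case (Suc j)
    \<comment> \<open>For even \<open>n\<close> the left sum has one more index, \<open>k = n/2\<close>, whose monomial is constant.\<close>
    have "(\<Sum>k\<le>n div 2. (-1) ^ k / fact k * u' (n - 2 * k) t)
      = (\<Sum>k\<le>j div 2. (-1) ^ k / fact k * u' (n - 2 * k) t)"
    proof (rule sum.mono_neutral_right)
      show "\<forall>k\<in>{..n div 2} - {..j div 2}. (-1) ^ k / fact k * u' (n - 2 * k) t = 0"
      proof
        fix k assume "k \<in> {..n div 2} - {..j div 2}"
        then have "n - 2 * k = 0" by (auto simp: Suc)
        then show "(-1) ^ k / fact k * u' (n - 2 * k) t = 0" by (simp add: u'_def)
      qed
    qed (auto simp: Suc)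
    also have "\<dots> = 2 * (\<Sum>k\<le>j div 2. (-1) ^ k / fact k * u (j - 2 * k) t)"
      unfolding sum_distrib_left
    proof (intro sum.cong refl)
      fix k assume "k \<in> {..j div 2}"
      then have "n - 2 * k \<noteq> 0" "n - 2 * k - 1 = j - 2 * k" by (auto simp: Suc)
      then show "(-1) ^ k / fact k * u' (n - 2 * k) t = 2 * ((-1) ^ k / fact k * u (j - 2 * k) t)"
        by (simp add: u'_def)
    qed
    moreover have "int n - 1 = int j" "(fact n :: complex) = of_nat n * fact j"
      by (simp_all add: Suc)
    ultimately show ?thesis
      by (simp add: H)
  qed (simp add: u'_def)
  ultimately show ?thesis
    by (simp add: H[abs_def])
qed

section \<open>Mehler formula\<close>

lemma sums_even_odd:
  fixes f :: "nat \<Rightarrow> complex"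
  assumes "(\<lambda>m. f (2 * m)) sums a" "(\<lambda>m. f (2 * m + 1)) sums b"
  shows "f sums (a + b)"
proof -
  have "(\<lambda>n. if even n then f n else 0) sums a"
    by (subst sums_mono_reindex[of "\<lambda>m. 2 * m", symmetric])
       (use assms(1) in \<open>auto simp: strict_mono_def elim!: evenE\<close>)
  moreover have "(\<lambda>n. if odd n then f n else 0) sums b"
    by (subst sums_mono_reindex[of "\<lambda>m. 2 * m + 1", symmetric])
       (use assms(2) in \<open>auto simp: strict_mono_def elim!: oddE\<close>)
  ultimately have "(\<lambda>n. (if even n then f n else 0) + (if odd n then f n else 0)) sums (a + b)"
    by (rule sums_add)
  then show ?thesis
    by (rule sums_cong[THEN iffD1, rotated]) simp
qed

lemma e_mu_eq:
  assumes "\<mu> \<in> C_o"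
  shows "e_mu \<mu> (2 * u)
     = hyp_0F1 (\<mu> + 1/2) (u\<^sup>2) + u / (\<mu> + 1/2) * hyp_0F1 (\<mu> + 3/2) (u\<^sup>2)"
proof -
  define a where "a = \<mu> + 1/2"
  have a: "a + of_nat k \<noteq> 0" for k
    unfolding a_def by (rule C_o_neq[OF assms])
  have a1: "\<mu> + 3/2 = a + 1" by (simp add: a_def)
  have a1': "a + 1 + of_nat k \<noteq> 0" for k
    using a[of "Suc k"] by (simp add: add_ac)
  have "(\<lambda>m. (2 * u) ^ m / gamma_mu \<mu> m) sums
      (hyp_0F1 a (u\<^sup>2) + u / a * hyp_0F1 (a + 1) (u\<^sup>2))"
  proof (rule sums_even_odd)
    have "(2 * u) ^ (2 * m) / gamma_mu \<mu> (2 * m) = (u\<^sup>2) ^ m / (fact m * pochhammer a m)" for m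
      unfolding gamma_mu_even[OF assms] a_def[symmetric] by (simp add: power_mult power_mult_distrib)
    then show "(\<lambda>m. (2 * u) ^ (2 * m) / gamma_mu \<mu> (2 * m)) sums hyp_0F1 a (u\<^sup>2)"
      using hyp_0F1_sums[OF a] by simp
    have "(2 * u) ^ (2 * m + 1) / gamma_mu \<mu> (2 * m + 1)
        = u / a * ((u\<^sup>2) ^ m / (fact m * pochhammer (a + 1) m))" for m
      unfolding gamma_mu_odd[OF assms] a_def[symmetric]
      by (simp add: power_mult power_mult_distrib pochhammer_rec)
    then show "(\<lambda>m. (2 * u) ^ (2 * m + 1) / gamma_mu \<mu> (2 * m + 1)) sums
        (u / a * hyp_0F1 (a + 1) (u\<^sup>2))"
      using sums_mult[OF hyp_0F1_sums[OF a1'], of "u / a"] by simp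
  qed
  then show ?thesis
    unfolding e_mu_def a_def[symmetric] a1 by (rule sums_unique[symmetric])
qed

lemma gen_hermite_mehler:
  assumes "\<mu> \<in> C_o" "norm z < 1"
  shows "(\<lambda>j. gamma_mu \<mu> j / (2 ^ j * (fact j) ^ 2)
            * gen_hermite \<mu> (int j) x * gen_hermite \<mu> (int j) y * z ^ j)
       sums (1 / (1 - z ^ 2) powr (\<mu> + 1/2)
               * exp (- (x ^ 2 + y ^ 2) * (z ^ 2 / (1 - z ^ 2)))
               * e_mu \<mu> (2 * x * y * (z / (1 - z ^ 2))))"
    (is "?t sums ?R")
proof -
  define a where "a = \<mu> + 1/2"
  have a: "a + of_nat k \<noteq> 0" for k
    unfolding a_def by (rule C_o_neq[OF assms(1)])
  have a0: "a \<noteq> 0" using a[of 0] by simp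
  have a1: "\<mu> + 3/2 = a + 1" by (simp add: a_def)
  have a1': "a + 1 + of_nat k \<noteq> 0" for k
    using a[of "Suc k"] by (simp add: add_ac)
  define w where "w = z\<^sup>2"
  have w: "norm w < 1"
    using assms(2) by (simp add: w_def norm_power power_less_one_iff abs_square_less_1)
  then have nz: "1 - w \<noteq> 0" by auto
  define E where "E = exp (- (x\<^sup>2 + y\<^sup>2) * w / (1 - w))"
  define u where "u = x * y * z / (1 - w)"
  have u2: "x\<^sup>2 * y\<^sup>2 * w / (1 - w)\<^sup>2 = u\<^sup>2"
    by (simp add: u_def w_def power_mult_distrib power_divide)
  have "?t sums ((1 - w) powr (- a) * E * hyp_0F1 a (u\<^sup>2)
       + x * y * z / a * ((1 - w) powr (- (a + 1)) * E * hyp_0F1 (a + 1) (u\<^sup>2)))"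
  proof (rule sums_even_odd)
    have "?t (2 * m) = pochhammer a m / fact m * w ^ m * kummer_poly a m (x\<^sup>2) * kummer_poly a m (y\<^sup>2)" for m
    proof -
      define F where "F = (fact (2 * m) :: complex)"
      have "F \<noteq> 0" by (simp add: F_def)
      then show ?thesis
        unfolding gen_hermite_even[OF assms(1)] gamma_mu_even[OF assms(1)] a_def[symmetric] w_def
          F_def[symmetric]
        by (simp add: power_mult power2_eq_square)
    qed
    then show "(\<lambda>m. ?t (2 * m)) sums ((1 - w) powr (- a) * E * hyp_0F1 a (u\<^sup>2))"
      using hille_hardy[OF a w, of "x\<^sup>2" "y\<^sup>2"] unfolding u2 E_def by simp
    have "?t (2 * m + 1) = x * y * z / a * (pochhammer (a + 1) m / fact m * w ^ m *
        kummer_poly (a + 1) m (x\<^sup>2) * kummer_poly (a + 1) m (y\<^sup>2))" for m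
    proof -
      define F where "F = (fact (2 * m + 1) :: complex)"
      have "F \<noteq> 0" by (simp add: F_def del: fact_Suc)
      then show ?thesis
        unfolding gen_hermite_odd[OF assms(1)] gamma_mu_odd[OF assms(1)] a_def[symmetric] w_def a1
          F_def[symmetric]
        using a0 by (simp add: power_mult power2_eq_square pochhammer_rec) (simp add: mult_ac)
    qed
    then show "(\<lambda>m. ?t (2 * m + 1)) sums
        (x * y * z / a * ((1 - w) powr (- (a + 1)) * E * hyp_0F1 (a + 1) (u\<^sup>2)))"
      using sums_mult[OF hille_hardy[OF a1' w, of "x\<^sup>2" "y\<^sup>2"], of "x * y * z / a"]
      unfolding u2 E_def by simp
  qed
  also have "(1 - w) powr (- a) * E * hyp_0F1 a (u\<^sup>2)
       + x * y * z / a * ((1 - w) powr (- (a + 1)) * E * hyp_0F1 (a + 1) (u\<^sup>2)) = ?R"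
  proof -
    have e: "2 * x * y * (z / (1 - w)) = 2 * u" by (simp add: u_def)
    have p: "(1 - w) powr (- (a + 1)) = (1 - w) powr (- a) / (1 - w)"
      using nz powr_diff[of "1 - w" "- a" 1] by simp
    have q: "1 / (1 - w) powr a = (1 - w) powr (- a)"
      by (simp add: powr_minus inverse_eq_divide)
    show ?thesis
      unfolding w_def[symmetric] e e_mu_eq[OF assms(1)] a_def[symmetric] a1 p q E_def
      by (simp add: u_def distrib_left mult_ac)
  qed
  finally show ?thesis .
qed

lemma gen_hermite_even_genfun:
  assumes "\<mu> \<in> C_o" "norm z < 1"
  shows "(\<lambda>j. gamma_mu \<mu> (2 * j) / fact (2 * j) * gen_hermite \<mu> (int (2 * j)) x
            * ((-1) ^ j / fact j) * (z / 2) ^ (2 * j))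
       sums (1 / (1 - z ^ 2) powr (\<mu> + 1/2) * exp (- (x ^ 2 * z ^ 2) / (1 - z ^ 2)))"
proof -
  define a where "a = \<mu> + 1/2"
  have a: "a + of_nat k \<noteq> 0" for k
    unfolding a_def by (rule C_o_neq[OF assms(1)])
  have w: "norm (z\<^sup>2) < 1"
    using assms(2) by (simp add: norm_power power_less_one_iff abs_square_less_1)
  have "gamma_mu \<mu> (2 * j) / fact (2 * j) * gen_hermite \<mu> (int (2 * j)) x
            * ((-1) ^ j / fact j) * (z / 2) ^ (2 * j)
      = pochhammer (a + of_nat 0) j / fact j * (z\<^sup>2) ^ j * kummer_poly a (j + 0) (x\<^sup>2)" for j
    unfolding gen_hermite_even[OF assms(1)] gamma_mu_even[OF assms(1)] a_def[symmetric]
    by (simp add: power_mult power_divide)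
  moreover have "1 / (1 - z\<^sup>2) powr a = (1 - z\<^sup>2) powr (- a)"
    by (simp add: powr_minus inverse_eq_divide)
  ultimately show ?thesis
    using kummer_poly_genfun[OF a w, of 0 "x\<^sup>2"] by (simp add: a_def)
qed

section \<open>Raising relations and their iterates\<close>

lemma gamma_mu_ratio:
  assumes "\<mu> \<in> C_o"
  shows "gamma_mu \<mu> (n + 1) / (of_nat (n + 1) * gamma_mu \<mu> n) = 1 + 2 * \<mu> * theta (n + 1) / of_nat (n + 1)"
proof -
  have "of_nat (n + 1) \<noteq> (0 :: complex)" unfolding of_nat_eq_0_iff by simp
  then show ?thesis
    using gamma_mu_Suc[OF assms, of n] gamma_mu_nonzero[OF assms, of n]
    by (simp add: add_divide_distrib del: of_nat_Suc of_nat_add)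
qed

lemma raising_op_gen_hermite:
  assumes "\<mu> \<in> C_o"
  shows "raising_op \<mu> (\<lambda>t. c * gen_hermite \<mu> (int n) t)
     = (\<lambda>t. c * ((1 + 2 * \<mu> * theta (n + 1) / of_nat (n + 1)) * gen_hermite \<mu> (int n + 1) t))"
proof
  fix t
  have "(1 + 2 * \<mu> * theta (n + 1) / of_nat (n + 1)) * gen_hermite \<mu> (int n + 1) t
      = 2 * t * gen_hermite \<mu> (int n) t - 2 * of_nat n * gen_hermite \<mu> (int n - 1) t"
    using gen_hermite_recursion[OF assms, of n t] by (simp add: algebra_simps)
  then show "raising_op \<mu> (\<lambda>t. c * gen_hermite \<mu> (int n) t) t
     = c * ((1 + 2 * \<mu> * theta (n + 1) / of_nat (n + 1)) * gen_hermite \<mu> (int n + 1) t)"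
    unfolding raising_op_def Q_op_def
      has_dunkl_imp_dunkl[OF has_dunkl_cmult[OF has_dunkl_gen_hermite[OF assms]]]
    by (simp only:) (simp add: algebra_simps)
qed

lemma has_dunkl_gaussian_gen_hermite:
  assumes "\<mu> \<in> C_o"
  shows "has_dunkl \<mu> (\<lambda>t. exp (- (lam ^ 2 * t ^ 2)) * gen_hermite \<mu> (int n) (lam * t))
     (\<lambda>t. - lam * exp (- (lam ^ 2 * t ^ 2))
         * ((1 + 2 * \<mu> * theta (n + 1) / of_nat (n + 1)) * gen_hermite \<mu> (int n + 1) (lam * t)))"
proof -
  have "has_dunkl \<mu> (\<lambda>t. exp (- (lam ^ 2 * t ^ 2)) * gen_hermite \<mu> (int n) (lam * t))
     (\<lambda>t. exp (- (lam ^ 2 * t ^ 2)) * (- (2 * lam ^ 2 * t)) * gen_hermite \<mu> (int n) (lam * t)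
        + exp (- (lam ^ 2 * t ^ 2)) * (lam * (2 * of_nat n * gen_hermite \<mu> (int n - 1) (lam * t))))"
    by (intro has_dunkl_even_mult has_dunkl_scale[OF has_dunkl_gen_hermite[OF assms]])
       (auto intro!: derivative_eq_intros simp: mult_ac)
  moreover have "exp (- (lam ^ 2 * t ^ 2)) * (- (2 * lam ^ 2 * t)) * gen_hermite \<mu> (int n) (lam * t)
        + exp (- (lam ^ 2 * t ^ 2)) * (lam * (2 * of_nat n * gen_hermite \<mu> (int n - 1) (lam * t)))
      = - lam * exp (- (lam ^ 2 * t ^ 2))
         * ((1 + 2 * \<mu> * theta (n + 1) / of_nat (n + 1)) * gen_hermite \<mu> (int n + 1) (lam * t))" for t
  proof -
    have "(1 + 2 * \<mu> * theta (n + 1) / of_nat (n + 1)) * gen_hermite \<mu> (int n + 1) (lam * t)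
       = 2 * (lam * t) * gen_hermite \<mu> (int n) (lam * t)
         - 2 * of_nat n * gen_hermite \<mu> (int n - 1) (lam * t)"
      using gen_hermite_recursion[OF assms, of n "lam * t"] by (simp add: algebra_simps)
    then show ?thesis
      by (simp only:) (simp add: algebra_simps power2_eq_square)
  qed
  ultimately show ?thesis
    by simp
qed

lemma gen_hermite_0:
  assumes "\<mu> \<in> C_o"
  shows "gen_hermite \<mu> 0 x = 1"
  using gen_hermite_even[OF assms, of 0 x] by simp

lemma gamma_mu_over_fact_Suc:
  assumes "\<mu> \<in> C_o"
  shows "gamma_mu \<mu> n / fact n * (1 + 2 * \<mu> * theta (n + 1) / of_nat (n + 1))
     = gamma_mu \<mu> (Suc n) / fact (Suc n)"
  unfolding gamma_mu_ratio[OF assms, symmetric] using gamma_mu_nonzero[OF assms, of n] by simp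

lemma raising_op_iterate:
  assumes "\<mu> \<in> C_o"
  shows "(raising_op \<mu> ^^ n) (gen_hermite \<mu> 0) = (\<lambda>t. gamma_mu \<mu> n / fact n * gen_hermite \<mu> (int n) t)"
proof (induction n)
  case (Suc n)
  have e: "int (Suc n) = int n + 1" by simp
  show ?case
    unfolding funpow.simps comp_def Suc.IH raising_op_gen_hermite[OF assms] mult.assoc[symmetric]
      gamma_mu_over_fact_Suc[OF assms] e ..
qed (use assms in simp)

lemma dunkl_iterate_gaussian:
  assumes "\<mu> \<in> C_o"
  shows "(dunkl \<mu> ^^ n) (\<lambda>t. exp (- (lam ^ 2 * t ^ 2)))
     = (\<lambda>t. (- lam) ^ n * (gamma_mu \<mu> n / fact n)
              * (exp (- (lam ^ 2 * t ^ 2)) * gen_hermite \<mu> (int n) (lam * t)))"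
proof (induction n)
  case (Suc n)
  have e: "int (Suc n) = int n + 1" by simp
  show ?case
    unfolding funpow.simps comp_def Suc.IH
      has_dunkl_imp_dunkl[OF has_dunkl_cmult[OF has_dunkl_gaussian_gen_hermite[OF assms]]]
      gamma_mu_over_fact_Suc[OF assms, symmetric] e
    by (simp only: power_Suc mult_ac)
qed (use assms in \<open>simp add: gen_hermite_0\<close>)

section \<open>Identities for generalized Hermite polynomials\<close>

theorem mainTheorem2:
  fixes \<mu> lam x y z :: complex and n :: nat
  assumes "\<mu> \<in> C_o" and "norm z < 1"
  shows
   "(dunkl \<mu> (\<lambda>t. gen_hermite \<mu> (int n) (lam * t)) x
       = 2 * lam * of_nat n * gen_hermite \<mu> (int n - 1) (lam * x)) \<and>
    (raising_op \<mu> (gen_hermite \<mu> (int n))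
       = (\<lambda>t. gamma_mu \<mu> (n + 1) / (of_nat (n + 1) * gamma_mu \<mu> n)
                * gen_hermite \<mu> (int n + 1) t)) \<and>
    ((\<lambda>t. gamma_mu \<mu> (n + 1) / (of_nat (n + 1) * gamma_mu \<mu> n)
            * gen_hermite \<mu> (int n + 1) t)
       = (\<lambda>t. (1 + 2 * \<mu> * theta (n + 1) / of_nat (n + 1)) * gen_hermite \<mu> (int n + 1) t)) \<and>
    ((\<lambda>t. 2 * of_nat n * gen_hermite \<mu> (int n - 1) t
            + gamma_mu \<mu> (n + 1) / (of_nat (n + 1) * gamma_mu \<mu> n)
                * gen_hermite \<mu> (int n + 1) t)
       = (\<lambda>t. 2 * Q_op (gen_hermite \<mu> (int n)) t)) \<and>
    (dunkl \<mu> (\<lambda>t. exp (- (lam ^ 2 * t ^ 2)) * gen_hermite \<mu> (int n) (lam * t)) x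
       = - lam * exp (- (lam ^ 2 * x ^ 2))
           * (gamma_mu \<mu> (n + 1) / (of_nat (n + 1) * gamma_mu \<mu> n))
           * gen_hermite \<mu> (int n + 1) (lam * x)) \<and>
    ((-1) ^ n * exp (lam ^ 2 * x ^ 2) * (dunkl \<mu> ^^ n) (\<lambda>t. exp (- (lam ^ 2 * t ^ 2))) x
       = lam ^ n * (gamma_mu \<mu> n / fact n) * gen_hermite \<mu> (int n) (lam * x)) \<and>
    (gen_hermite \<mu> (int n)
       = (\<lambda>t. fact n / gamma_mu \<mu> n * (raising_op \<mu> ^^ n) (gen_hermite \<mu> 0) t)) \<and>
    ((2 * x) ^ n / gamma_mu \<mu> n
       = (\<Sum>k = 0..n div 2. gen_hermite \<mu> (int (n - 2 * k)) x / (fact k * fact (n - 2 * k)))) \<and>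
    ((\<lambda>j. gamma_mu \<mu> j / (2 ^ j * (fact j) ^ 2)
            * gen_hermite \<mu> (int j) x * gen_hermite \<mu> (int j) y * z ^ j)
       sums (1 / (1 - z ^ 2) powr (\<mu> + 1/2)
               * exp (- (x ^ 2 + y ^ 2) * (z ^ 2 / (1 - z ^ 2)))
               * e_mu \<mu> (2 * x * y * (z / (1 - z ^ 2))))) \<and>
    ((\<lambda>j. gamma_mu \<mu> (2 * j) / fact (2 * j) * gen_hermite \<mu> (int (2 * j)) x
            * ((-1) ^ j / fact j) * (z / 2) ^ (2 * j))
       sums (1 / (1 - z ^ 2) powr (\<mu> + 1/2) * exp (- (x ^ 2 * z ^ 2) / (1 - z ^ 2))))"
proof (intro conjI)
  note C = \<open>\<mu> \<in> C_o\<close>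
  have \<gamma>: "gamma_mu \<mu> n \<noteq> 0"
    by (rule gamma_mu_nonzero[OF C])
  show "dunkl \<mu> (\<lambda>t. gen_hermite \<mu> (int n) (lam * t)) x
       = 2 * lam * of_nat n * gen_hermite \<mu> (int n - 1) (lam * x)"
    by (simp add: has_dunkl_imp_dunkl[OF has_dunkl_scale[OF has_dunkl_gen_hermite[OF C]]])
  show "raising_op \<mu> (gen_hermite \<mu> (int n))
       = (\<lambda>t. gamma_mu \<mu> (n + 1) / (of_nat (n + 1) * gamma_mu \<mu> n)
                * gen_hermite \<mu> (int n + 1) t)"
    using raising_op_gen_hermite[OF C, of 1 n] unfolding gamma_mu_ratio[OF C] by simp
  show "(\<lambda>t. gamma_mu \<mu> (n + 1) / (of_nat (n + 1) * gamma_mu \<mu> n)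
            * gen_hermite \<mu> (int n + 1) t)
       = (\<lambda>t. (1 + 2 * \<mu> * theta (n + 1) / of_nat (n + 1)) * gen_hermite \<mu> (int n + 1) t)"
    unfolding gamma_mu_ratio[OF C] ..
  show "(\<lambda>t. 2 * of_nat n * gen_hermite \<mu> (int n - 1) t
            + gamma_mu \<mu> (n + 1) / (of_nat (n + 1) * gamma_mu \<mu> n)
                * gen_hermite \<mu> (int n + 1) t)
       = (\<lambda>t. 2 * Q_op (gen_hermite \<mu> (int n)) t)"
    unfolding gamma_mu_ratio[OF C] gen_hermite_recursion[OF C] by (simp add: Q_op_def mult.assoc)
  show "dunkl \<mu> (\<lambda>t. exp (- (lam ^ 2 * t ^ 2)) * gen_hermite \<mu> (int n) (lam * t)) x
       = - lam * exp (- (lam ^ 2 * x ^ 2))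
           * (gamma_mu \<mu> (n + 1) / (of_nat (n + 1) * gamma_mu \<mu> n))
           * gen_hermite \<mu> (int n + 1) (lam * x)"
    unfolding gamma_mu_ratio[OF C] has_dunkl_imp_dunkl[OF has_dunkl_gaussian_gen_hermite[OF C]] mult.assoc ..
  show "(-1) ^ n * exp (lam ^ 2 * x ^ 2) * (dunkl \<mu> ^^ n) (\<lambda>t. exp (- (lam ^ 2 * t ^ 2))) x
       = lam ^ n * (gamma_mu \<mu> n / fact n) * gen_hermite \<mu> (int n) (lam * x)"
  proof -
    have "(-1) ^ n * (- lam) ^ n = lam ^ n"
      by (simp flip: power_mult_distrib)
    moreover have "exp (lam ^ 2 * x ^ 2) * exp (- (lam ^ 2 * x ^ 2)) = 1"
      by (simp flip: exp_add)
    moreover have "(-1) ^ n * exp (lam ^ 2 * x ^ 2) * ((- lam) ^ n * g * (exp (- (lam ^ 2 * x ^ 2)) * h))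
        = ((-1) ^ n * (- lam) ^ n) * (exp (lam ^ 2 * x ^ 2) * exp (- (lam ^ 2 * x ^ 2))) * (g * h)" for g h
      by (simp only: mult_ac)
    ultimately show ?thesis
      unfolding dunkl_iterate_gaussian[OF C] by simp
  qed
  show "gen_hermite \<mu> (int n)
       = (\<lambda>t. fact n / gamma_mu \<mu> n * (raising_op \<mu> ^^ n) (gen_hermite \<mu> 0) t)"
    unfolding raising_op_iterate[OF C] using \<gamma> by simp
qed (rule gen_hermite_inversion[OF assms(1)] gen_hermite_mehler[OF assms] gen_hermite_even_genfun[OF assms])+

end
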